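(* Let $G$ be an infinite group and let $\mu$ be a symmetric, finitely supported generating probability measure on $G$. Then the real vector space $H(G,\mu)$ of harmonic functions on $(G,\mu)$ is finite dimensional if and only if $G$ contains a finite-index subgroup isomorphic to $(\mathbb{Z},+)$.
   Context: A probability measure $\mu$ on a group $G$ is generating if the semigroup generated by its support $\operatorname{supp}\mu$ is $G$, and symmetric if $\mu(g)=\mu(g^{-1})$ for all $g\in G$. A function $f:G\to\mathbb{R}$ is harmonic with respect to $\mu$ if $f(x)=\sum_{s\in\operatorname{supp}\mu}\mu(s)f(xs)$ for every $x\in G$; $H(G,\mu)$ denotes the space of all such functions. *)

theory Defs
  imports Complex_Main "HOL-Algebra.Elementary_Groups"
begin

definition msupp :: "('a, 'b) monoid_scheme \<Rightarrow> ('a \<Rightarrow> real) \<Rightarrow> 'a set" where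
  "msupp G \<mu> = {g \<in> carrier G. \<mu> g \<noteq> 0}"

inductive_set gen_semigroup :: "('a, 'b) monoid_scheme \<Rightarrow> 'a set \<Rightarrow> 'a set"
  for G :: "('a, 'b) monoid_scheme" and S :: "'a set" where
  base: "s \<in> S \<Longrightarrow> s \<in> gen_semigroup G S"
| step: "x \<in> gen_semigroup G S \<Longrightarrow> s \<in> S \<Longrightarrow> x \<otimes>\<^bsub>G\<^esub> s \<in> gen_semigroup G S"

definition fin_prob_measure :: "('a, 'b) monoid_scheme \<Rightarrow> ('a \<Rightarrow> real) \<Rightarrow> bool" where
  "fin_prob_measure G \<mu> \<longleftrightarrow> (\<forall>g \<in> carrier G. \<mu> g \<ge> 0) \<and> finite (msupp G \<mu>)
     \<and> (\<Sum>g \<in> msupp G \<mu>. \<mu> g) = 1"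

definition symmetric_measure :: "('a, 'b) monoid_scheme \<Rightarrow> ('a \<Rightarrow> real) \<Rightarrow> bool" where
  "symmetric_measure G \<mu> \<longleftrightarrow> (\<forall>g \<in> carrier G. \<mu> g = \<mu> (inv\<^bsub>G\<^esub> g))"

definition generating_measure :: "('a, 'b) monoid_scheme \<Rightarrow> ('a \<Rightarrow> real) \<Rightarrow> bool" where
  "generating_measure G \<mu> \<longleftrightarrow> gen_semigroup G (msupp G \<mu>) = carrier G"

text \<open>Harmonic functions G \<rightarrow> \<real>, represented as functions on the carrier
  (extended by 0 outside the carrier, so that they form a real vector space
  isomorphic to the space of functions on the carrier).\<close>
definition harmonic_functions :: "('a, 'b) monoid_scheme \<Rightarrow> ('a \<Rightarrow> real) \<Rightarrow> ('a \<Rightarrow> real) set" where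
  "harmonic_functions G \<mu> = {f. (\<forall>x. x \<notin> carrier G \<longrightarrow> f x = 0) \<and>
      (\<forall>x \<in> carrier G. f x = (\<Sum>s \<in> msupp G \<mu>. \<mu> s * f (x \<otimes>\<^bsub>G\<^esub> s)))}"

definition fin_dim_fun_space :: "('a \<Rightarrow> real) set \<Rightarrow> bool" where
  "fin_dim_fun_space V \<longleftrightarrow> (\<exists>B. finite B \<and> B \<subseteq> V \<and>
      (\<forall>f \<in> V. \<exists>c. f = (\<lambda>x. \<Sum>b \<in> B. c b * b x)))"

end

theory Submission
  imports Defs "HOL-Library.Function_Algebras"
begin

text \<open>
  Write \<open>\<Delta> f x = f x - (\<Sum>s. \<mu> s * f (x s))\<close>. If \<open>G\<close> is covered by finitely many translates
  \<open>\<langle>t\<rangle> r\<close> of a cyclic group, the slabs of all \<open>t\<^sup>i r\<close> with \<open>\<bar>i\<bar> \<le> n\<close> exhaust \<open>G\<close> and have boundaries of bounded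
  size, and by the maximum principle a harmonic function is determined on a slab by its boundary values.

  Conversely let the harmonic functions be finite dimensional and determined by their (arbitrary) values
  on a finite set \<open>B\<close>. By duality each delta function is uniquely \<open>\<Delta> \<psi>\<^sub>x\<close> plus a function on \<open>B\<close>, with
  \<open>\<psi>\<^sub>x\<close> finitely supported. Building \<open>\<psi>\<^sub>x\<close> step by step along a path from \<open>\<one>\<close> to \<open>x\<close> shows, by uniqueness,
  that \<open>\<psi>\<^sub>x\<close> is supported within bounded distance of every such path, while its support cannot avoid the
  region far from both endpoints, because the values of \<open>\<Delta> \<psi>\<close> sum to 0. Hence some finite set cuts \<open>G\<close> into
  two infinite pieces. There are at most \<open>2 \<bar>B\<bar>\<close> disjoint infinite sets with finite boundary, by a dimension
  count, so an infinite, coinfinite set \<open>A\<close> with finite boundary is preserved modulo finite sets by a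
  finite-index subgroup, on which \<open>g \<mapsto> \<bar>A - g A\<bar> - \<bar>g A - A\<bar>\<close> is a homomorphism to the integers. Its kernel is
  finite, since \<open>A\<close> and \<open>g A\<close> are strictly nested for all but finitely many \<open>g\<close>.
\<close>

section \<open>The Laplacian\<close>

lemma underdetermined_system_nontrivial_solution:
  fixes a :: "'i \<Rightarrow> 'j \<Rightarrow> real"
  assumes "finite J" "finite I" "card J < card I"
  shows "\<exists>c. (\<exists>i\<in>I. c i \<noteq> 0) \<and> (\<forall>j\<in>J. (\<Sum>i\<in>I. c i * a i j) = 0)"
  using assms
proof (induction J arbitrary: I a rule: finite_induct)
  case empty
  then have "I \<noteq> {}" by auto
  then show ?case by (intro exI[of _ "\<lambda>_. 1"]) auto
next
  case (insert j J)
  show ?case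
  proof (cases "\<forall>i\<in>I. a i j = 0")
    case True
    have "card J < card I" using insert by simp
    from insert.IH[OF insert.prems(1) this, of a] True show ?thesis by auto
  next
    case False
    then obtain k where k: "k \<in> I" "a k j \<noteq> 0" by blast
    have "card J < card (I - {k})" using insert k by simp
    \<comment> \<open>Gaussian elimination: equation \<open>j\<close> is solved for the unknown at
      \<open>k\<close>, and substitution leaves a system with one equation and one unknown
      fewer.\<close>
    from insert.IH[OF _ this, of "\<lambda>i l. a i l - a i j / a k j * a k l"] insert.prems
    obtain c where c: "\<exists>i\<in>I - {k}. c i \<noteq> 0"
      and c0: "\<And>l. l \<in> J \<Longrightarrow> (\<Sum>i\<in>I - {k}. c i * (a i l - a i j / a k j * a k l)) = 0"
      by auto
    define d where "d = (\<lambda>i. if i = k then - (\<Sum>i\<in>I - {k}. c i * a i j) / a k j else c i)"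
    have split: "(\<Sum>i\<in>I. d i * a i l) =
        - (\<Sum>i\<in>I - {k}. c i * a i j) / a k j * a k l + (\<Sum>i\<in>I - {k}. c i * a i l)" for l
    proof -
      have "(\<Sum>i\<in>I. d i * a i l) = d k * a k l + (\<Sum>i\<in>I - {k}. d i * a i l)"
        using insert.prems k by (simp add: sum.remove)
      also have "(\<Sum>i\<in>I - {k}. d i * a i l) = (\<Sum>i\<in>I - {k}. c i * a i l)"
        by (rule sum.cong) (auto simp: d_def)
      finally show ?thesis by (simp add: d_def)
    qed
    have "(\<Sum>i\<in>I. d i * a i l) = 0" if "l \<in> J" for l
    proof -
      have "(\<Sum>i\<in>I - {k}. c i * a i l) - (\<Sum>i\<in>I - {k}. c i * a i j) / a k j * a k l = 0"
        using c0[OF that]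
        by (simp add: right_diff_distrib sum_subtractf sum_distrib_right sum_divide_distrib mult.assoc)
      then show ?thesis by (simp add: split)
    qed
    moreover have "(\<Sum>i\<in>I. d i * a i j) = 0" using k by (simp add: split)
    moreover have "\<exists>i\<in>I. d i \<noteq> 0" using c by (auto simp: d_def)
    ultimately show ?thesis by (intro exI[of _ d]) auto
  qed
qed

lemma sum_mult_of_bool_eq_single:
  fixes f :: "'a \<Rightarrow> real"
  shows "finite A \<Longrightarrow> (\<Sum>x\<in>A. f x * of_bool (x = a)) = (if a \<in> A then f a else 0)"
  by (simp add: of_bool_def if_distrib cong: if_cong)

interpretation fun_space: vector_space "\<lambda>(c::real) (f::'a \<Rightarrow> real) x. c * f x"
  by unfold_locales (auto simp: fun_eq_iff algebra_simps)

text \<open>A basis \<open>E\<close> of the span of \<open>W\<close> stays independent after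
  \<open>f\<close> is adjoined, so the prescription 1 at \<open>f\<close> and 0 on \<open>E\<close>
  extends to a linear functional on all functions.\<close>

lemma functional_separating_span:
  fixes f :: "'a \<Rightarrow> real"
  assumes "f \<notin> fun_space.span W"
  obtains F :: "('a \<Rightarrow> real) \<Rightarrow> real" where
    "\<And>g h. F (\<lambda>x. g x + h x) = F g + F h" "\<And>c g. F (\<lambda>x. c * g x) = c * F g"
    "\<And>g. g \<in> W \<Longrightarrow> F g = 0" "F f = 1"
proof -
  interpret vector_space_pair "\<lambda>(c::real) (f::'a \<Rightarrow> real) x. c * f x" "(*) :: real \<Rightarrow> real \<Rightarrow> real"
    by unfold_locales (auto simp: algebra_simps)
  obtain E where E: "E \<subseteq> W" "fun_space.independent E" "W \<subseteq> fun_space.span E"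
    by (rule fun_space.maximal_independent_subset)
  have sp: "fun_space.span E = fun_space.span W"
    by (intro subset_antisym fun_space.span_mono fun_space.span_minimal fun_space.subspace_span E)
  then have "fun_space.independent (insert f E)"
    using assms E(2) by (intro fun_space.independent_insertI) auto
  from linear_independent_extend[OF this, of "\<lambda>g. if g = f then 1 else 0"]
  obtain F where lin: "Vector_Spaces.linear (\<lambda>c f x. c * f x) (*) F"
    and F: "\<And>g. g \<in> insert f E \<Longrightarrow> F g = (if g = f then 1 else 0)" by blast
  interpret F: Vector_Spaces.linear "\<lambda>(c::real) (f::'a \<Rightarrow> real) x. c * f x" "(*)" F by (rule lin)
  have "f \<notin> E" using assms E(1) by (auto dest: fun_space.span_base)
  have "F g = 0" if "g \<in> W" for g
  proof -
    have "g \<in> fun_space.span E" using that E by blast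
    then show ?thesis
    proof (induction rule: fun_space.span_induct)
      show "fun_space.subspace {x. F x = 0}"
        by (auto simp: fun_space.subspace_def F.add F.scale F.zero)
      show "F x = 0" if "x \<in> E" for x using F[of x] that \<open>f \<notin> E\<close> by auto
    qed
  qed
  moreover have "F f = 1" using F by auto
  ultimately show ?thesis
    using F.add F.scale by (intro that[of F]) (auto simp: plus_fun_def)
qed

section \<open>The random walk and its Laplacian\<close>

locale symmetric_walk = group G for G (structure) +
  fixes \<mu> :: "'a \<Rightarrow> real"
  assumes infinite_carrier: "infinite (carrier G)"
    and prob: "fin_prob_measure G \<mu>"
    and symmetric: "symmetric_measure G \<mu>"
    and generating: "generating_measure G \<mu>"
begin

abbreviation "S \<equiv> msupp G \<mu>"

lemma S_carrier: "s \<in> S \<Longrightarrow> s \<in> carrier G"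
  by (simp add: msupp_def)

lemma finite_S: "finite S"
  using prob by (simp add: fin_prob_measure_def)

lemma mu_pos: "s \<in> S \<Longrightarrow> \<mu> s > 0"
  using prob by (simp add: fin_prob_measure_def msupp_def order_less_le)

lemma sum_mu: "sum \<mu> S = 1"
  using prob by (simp add: fin_prob_measure_def)

lemma mu_inv: "x \<in> carrier G \<Longrightarrow> \<mu> (inv x) = \<mu> x"
  using symmetric unfolding symmetric_measure_def by metis

lemma S_inv: "s \<in> S \<Longrightarrow> inv s \<in> S"
  by (simp add: msupp_def mu_inv)

lemma sum_S_inv: "(\<Sum>s\<in>S. f (inv s)) = (\<Sum>s\<in>S. f s)"
  by (rule sum.reindex_bij_witness[of _ "\<lambda>s. inv s" "\<lambda>s. inv s"])
    (auto simp: S_inv S_carrier)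

text \<open>Connectedness of the Cayley graph: \<open>y\<close> is reached from \<open>x\<close> by
  multiplying with \<open>inv x \<otimes> y\<close>, which lies in the semigroup generated by
  \<open>S\<close>.\<close>

lemma step_closed_eq_carrier:
  assumes "E \<subseteq> carrier G" "E \<noteq> {}" "\<And>x s. x \<in> E \<Longrightarrow> s \<in> S \<Longrightarrow> x \<otimes> s \<in> E"
  shows "E = carrier G"
proof -
  obtain x where x: "x \<in> E" using assms(2) by blast
  have E: "g \<in> carrier G \<and> x \<otimes> g \<in> E" if "g \<in> gen_semigroup G S" for g
    using that
  proof induction
    case (base s) then show ?case using x assms(3) S_carrier by blast
  next
    case (step g s)
    then have "x \<otimes> g \<otimes> s \<in> E" using assms(3) by blast
    moreover have "x \<in> carrier G" "s \<in> carrier G" using x assms(1) step(2) S_carrier by auto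
    ultimately show ?case using step by (simp add: m_assoc)
  qed
  have "y \<in> E" if "y \<in> carrier G" for y
  proof -
    have xG: "x \<in> carrier G" using x assms(1) by blast
    then have "inv x \<otimes> y \<in> carrier G" using that by simp
    then have "x \<otimes> (inv x \<otimes> y) \<in> E" using E generating by (simp add: generating_measure_def)
    then show ?thesis using that xG by (simp flip: m_assoc)
  qed
  then show ?thesis using assms(1) by blast
qed

text \<open>The value 0 off the carrier makes harmonicity an equation between functions, as in
  \<open>H_iff\<close>.\<close>

definition Lap :: "('a \<Rightarrow> real) \<Rightarrow> 'a \<Rightarrow> real" where
  "Lap f x = (if x \<in> carrier G then f x - (\<Sum>s\<in>S. \<mu> s * f (x \<otimes> s)) else 0)"

definition finsup :: "('a \<Rightarrow> real) set" where
  "finsup = {f. finite {x. f x \<noteq> 0} \<and> {x. f x \<noteq> 0} \<subseteq> carrier G}"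

abbreviation delta :: "'a \<Rightarrow> 'a \<Rightarrow> real" where
  "delta y \<equiv> \<lambda>x. of_bool (x = y)"

abbreviation "H \<equiv> harmonic_functions G \<mu>"

lemma H_iff: "h \<in> H \<longleftrightarrow> (\<forall>x. x \<notin> carrier G \<longrightarrow> h x = 0) \<and> Lap h = (\<lambda>x. 0)"
  by (auto simp: harmonic_functions_def Lap_def fun_eq_iff)

lemma Lap_add: "Lap (\<lambda>x. f x + g x) = (\<lambda>x. Lap f x + Lap g x)"
  by (auto simp: Lap_def fun_eq_iff algebra_simps sum.distrib)

lemma Lap_scale: "Lap (\<lambda>x. c * f x) = (\<lambda>x. c * Lap f x)"
  by (auto simp: Lap_def fun_eq_iff algebra_simps sum_distrib_left)

lemma Lap_zero: "Lap (\<lambda>x. 0) = (\<lambda>x. 0)"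
  by (auto simp: Lap_def)

lemma Lap_diff: "Lap (\<lambda>x. f x - g x) = (\<lambda>x. Lap f x - Lap g x)"
  by (auto simp: Lap_def fun_eq_iff algebra_simps sum_subtractf)

lemma Lap_sum: "Lap (\<lambda>x. \<Sum>i\<in>I. c i * f i x) = (\<lambda>x. \<Sum>i\<in>I. c i * Lap (f i) x)"
  by (induction I rule: infinite_finite_induct) (simp_all add: Lap_zero Lap_add Lap_scale)

text \<open>Steps multiply on the right, so left translation commutes with the Laplacian.\<close>

lemma Lap_translate:
  assumes "g \<in> carrier G" "x \<in> carrier G"
  shows "Lap (\<lambda>x. f (inv g \<otimes> x)) x = Lap f (inv g \<otimes> x)"
  using assms by (auto simp: Lap_def m_assoc S_carrier intro!: sum.cong)

lemma finsupI:
  assumes "finite P" "P \<subseteq> carrier G" "\<And>x. x \<notin> P \<Longrightarrow> f x = 0"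
  shows "f \<in> finsup"
proof -
  have "{x. f x \<noteq> 0} \<subseteq> P" using assms(3) by auto
  then show ?thesis using assms(1,2) by (auto simp: finsup_def finite_subset)
qed

lemma finsup_zero: "(\<lambda>x. 0) \<in> finsup"
  by (rule finsupI[of "{}"]) auto

lemma finsup_add: "f \<in> finsup \<Longrightarrow> g \<in> finsup \<Longrightarrow> (\<lambda>x. f x + g x) \<in> finsup"
  by (rule finsupI[of "{x. f x \<noteq> 0} \<union> {x. g x \<noteq> 0}"]) (auto simp: finsup_def)

lemma finsup_scale: "f \<in> finsup \<Longrightarrow> (\<lambda>x. c * f x) \<in> finsup"
  by (rule finsupI[of "{x. f x \<noteq> 0}"]) (auto simp: finsup_def)

lemma finsup_diff: "f \<in> finsup \<Longrightarrow> g \<in> finsup \<Longrightarrow> (\<lambda>x. f x - g x) \<in> finsup"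
  by (rule finsupI[of "{x. f x \<noteq> 0} \<union> {x. g x \<noteq> 0}"]) (auto simp: finsup_def)

lemma finsup_sum: "(\<And>i. i \<in> I \<Longrightarrow> f i \<in> finsup) \<Longrightarrow> (\<lambda>x. \<Sum>i\<in>I. c i * f i x) \<in> finsup"
  by (induction I rule: infinite_finite_induct) (simp_all add: finsup_zero finsup_add finsup_scale)

lemma finsup_delta: "y \<in> carrier G \<Longrightarrow> delta y \<in> finsup"
  by (rule finsupI[of "{y}"]) auto

lemma finsup_translate:
  assumes "f \<in> finsup" "g \<in> carrier G"
  shows "(\<lambda>x. if x \<in> carrier G then f (inv g \<otimes> x) else 0) \<in> finsup"
proof (rule finsupI[of "(\<lambda>x. g \<otimes> x) ` {x. f x \<noteq> 0}"])
  fix x assume x: "x \<notin> (\<lambda>x. g \<otimes> x) ` {x. f x \<noteq> 0}"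
  show "(if x \<in> carrier G then f (inv g \<otimes> x) else 0) = 0"
  proof (rule ccontr)
    assume "\<not> ?thesis"
    then have "x = g \<otimes> (inv g \<otimes> x)" "f (inv g \<otimes> x) \<noteq> 0"
      using assms by (auto simp flip: m_assoc split: if_splits)
    then show False using x by blast
  qed
qed (use assms in \<open>auto simp: finsup_def\<close>)

section \<open>Maximum principle and self-adjointness\<close>

lemma maximum_principle_le:
  assumes "finite W" "W \<subseteq> carrier G" "\<And>x. x \<notin> W \<Longrightarrow> f x = 0"
    and harm: "\<And>x. x \<in> W \<Longrightarrow> Lap f x = 0"
  shows "f x \<le> 0"
proof (rule ccontr)
  assume "\<not> f x \<le> 0"
  then have pos: "f x > 0" and xW: "x \<in> W" using assms(3)[of x] by force+
  define m where "m = Max (f ` W)"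
  define E where "E = {y \<in> W. f y = m}"
  have fm: "f y \<le> m" if "y \<in> W" for y using that assms(1) by (simp add: m_def)
  have mpos: "m > 0" using pos fm[OF xW] by simp
  have le: "f y \<le> m" for y using fm[of y] assms(3)[of y] mpos by (cases "y \<in> W") auto
  have "m \<in> f ` W" unfolding m_def using assms(1) xW by (intro Max_in) auto
  then have "E \<noteq> {}" by (auto simp: E_def)
  \<comment> \<open>The maximum is an average, with positive weights, of values at most
    \<open>m\<close>, so all neighbours attain it. Then the finite set \<open>E\<close> would be the
    whole infinite group.\<close>
  moreover have "y \<otimes> s \<in> E" if y: "y \<in> E" and s: "s \<in> S" for y s
  proof -
    have "m = (\<Sum>s\<in>S. \<mu> s * f (y \<otimes> s))"
      using harm[of y] y assms(2) by (auto simp: E_def Lap_def)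
    moreover have "m = (\<Sum>s\<in>S. \<mu> s * m)" using sum_mu by (simp flip: sum_distrib_right)
    ultimately have "(\<Sum>s\<in>S. \<mu> s * (m - f (y \<otimes> s))) = 0"
      by (simp add: right_diff_distrib sum_subtractf)
    then have "\<mu> s * (m - f (y \<otimes> s)) = 0"
      using s finite_S le mu_pos by (subst (asm) sum_nonneg_eq_0_iff) (auto simp: less_imp_le)
    then have "f (y \<otimes> s) = m" using mu_pos[OF s] by simp
    then show ?thesis using assms(3)[of "y \<otimes> s"] mpos by (auto simp: E_def)
  qed
  ultimately have "E = carrier G" using assms(2) by (intro step_closed_eq_carrier) (auto simp: E_def)
  moreover have "finite E" using assms(1) by (simp add: E_def)
  ultimately show False using infinite_carrier by simp
qed

text \<open>Uniqueness for the Dirichlet problem on \<open>W\<close> with value 0 outside: the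
  one-sided bound is applied to \<open>f\<close> and to its negative.\<close>

lemma maximum_principle:
  assumes "finite W" "W \<subseteq> carrier G" "\<And>x. x \<notin> W \<Longrightarrow> f x = 0"
    and "\<And>x. x \<in> W \<Longrightarrow> Lap f x = 0"
  shows "f = (\<lambda>x. 0)"
proof
  fix x
  have "- f x \<le> 0"
    using assms Lap_scale[of "-1" f] by (intro maximum_principle_le[of W]) auto
  then show "f x = 0" using maximum_principle_le[OF assms, of x] by simp
qed

lemma Lap_finsup_inj: "f \<in> finsup \<Longrightarrow> Lap f = (\<lambda>x. 0) \<Longrightarrow> f = (\<lambda>x. 0)"
  by (rule maximum_principle[of "{x. f x \<noteq> 0}"]) (auto simp: finsup_def)

text \<open>Symmetry of \<mu> enters here: replacing \<open>s\<close> by \<open>inv s\<close> turns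
  steps into \<open>y\<close> into steps out of \<open>y\<close>.\<close>

lemma Lap_delta:
  assumes "y \<in> carrier G"
  shows "Lap (delta y) = (\<lambda>x. delta y x - (\<Sum>s\<in>S. \<mu> s * delta (y \<otimes> s) x))"
proof
  fix x
  show "Lap (delta y) x = delta y x - (\<Sum>s\<in>S. \<mu> s * delta (y \<otimes> s) x)"
  proof (cases "x \<in> carrier G")
    case True
    have "(\<Sum>s\<in>S. \<mu> s * delta y (x \<otimes> s)) = (\<Sum>s\<in>S. \<mu> (inv s) * delta y (x \<otimes> inv s))"
      using sum_S_inv[of "\<lambda>s. \<mu> s * delta y (x \<otimes> s)"] by simp
    also have "\<dots> = (\<Sum>s\<in>S. \<mu> s * delta (y \<otimes> s) x)"
    proof (rule sum.cong)
      fix s assume "s \<in> S"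
      then have "s \<in> carrier G" by (rule S_carrier)
      then have "(x \<otimes> inv s = y) = (x = y \<otimes> s)" using True assms
        by (auto simp: m_assoc)
      then show "\<mu> (inv s) * delta y (x \<otimes> inv s) = \<mu> s * delta (y \<otimes> s) x"
        using mu_inv \<open>s \<in> carrier G\<close> by simp
    qed simp
    finally show ?thesis using True by (simp add: Lap_def)
  next
    case False
    then have "x \<noteq> y" "\<And>s. s \<in> S \<Longrightarrow> x \<noteq> y \<otimes> s" using assms S_carrier by auto
    then show ?thesis using False by (simp add: Lap_def)
  qed
qed

lemma finsup_eq_sum_delta:
  assumes "f \<in> finsup"
  shows "f = (\<lambda>x. \<Sum>y\<in>{x. f x \<noteq> 0}. f y * delta y x)"
proof
  fix x
  show "f x = (\<Sum>y\<in>{x. f x \<noteq> 0}. f y * delta y x)"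
    using assms sum_mult_of_bool_eq_single[of "{x. f x \<noteq> 0}" f x]
    by (simp add: finsup_def eq_commute[of x])
qed

text \<open>Summation by parts moves the Laplacian onto \<open>h\<close>, where it vanishes. As
  \<open>f\<close> has finite support, it suffices to treat each \<open>delta y\<close> and add
  up.\<close>

lemma sum_harmonic_Lap:
  assumes h: "\<And>x. x \<in> carrier G \<Longrightarrow> Lap h x = 0" and f: "f \<in> finsup"
    and W: "finite W" "\<And>x. x \<notin> W \<Longrightarrow> Lap f x = 0"
  shows "(\<Sum>x\<in>W. h x * Lap f x) = 0"
proof -
  define P where "P = {x. f x \<noteq> 0}"
  have P: "finite P" "P \<subseteq> carrier G" using f by (auto simp: P_def finsup_def)
  have f_eq: "f = (\<lambda>x. \<Sum>y\<in>P. f y * delta y x)"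
    unfolding P_def by (rule finsup_eq_sum_delta[OF f])
  \<comment> \<open>The window also contains all neighbours of the support of \<open>f\<close>, so
    no mass of any \<open>Lap (delta y)\<close> is lost.\<close>
  define V where "V = W \<union> P \<union> (\<lambda>(y,s). y \<otimes> s) ` (P \<times> S)"
  have V: "finite V" "W \<subseteq> V" using P W finite_S by (auto simp: V_def)
  have pick: "(\<Sum>x\<in>V. h x * delta z x) = h z" if "z \<in> V" for z
    using V that by (simp add: sum_mult_of_bool_eq_single)
  have "(\<Sum>x\<in>V. h x * Lap (delta y) x) = 0" if y: "y \<in> P" for y
  proof -
    have "(\<Sum>x\<in>V. h x * Lap (delta y) x) =
        (\<Sum>x\<in>V. h x * delta y x) - (\<Sum>x\<in>V. \<Sum>s\<in>S. \<mu> s * (h x * delta (y \<otimes> s) x))"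
      using y P by (simp add: Lap_delta subset_iff right_diff_distrib sum_subtractf sum_distrib_left mult_ac)
    also have "(\<Sum>x\<in>V. h x * delta y x) = h y" using y by (intro pick) (auto simp: V_def)
    also have "(\<Sum>x\<in>V. \<Sum>s\<in>S. \<mu> s * (h x * delta (y \<otimes> s) x)) =
        (\<Sum>s\<in>S. \<mu> s * (\<Sum>x\<in>V. h x * delta (y \<otimes> s) x))"
      by (subst sum.swap) (simp add: sum_distrib_left)
    also have "\<dots> = (\<Sum>s\<in>S. \<mu> s * h (y \<otimes> s))"
      using y by (intro sum.cong refl arg_cong2[where f="(*)"] pick) (auto simp: V_def)
    finally show ?thesis using h[of y] y P by (auto simp: Lap_def)
  qed
  moreover have "(\<Sum>x\<in>V. h x * Lap f x) = (\<Sum>y\<in>P. f y * (\<Sum>x\<in>V. h x * Lap (delta y) x))"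
    by (subst f_eq, subst Lap_sum) (simp add: sum_distrib_left mult_ac sum.swap[of _ V])
  ultimately have "(\<Sum>x\<in>V. h x * Lap f x) = 0" by simp
  moreover have "(\<Sum>x\<in>V. h x * Lap f x) = (\<Sum>x\<in>W. h x * Lap f x)"
    using V W by (intro sum.mono_neutral_right) auto
  ultimately show ?thesis by simp
qed

lemma constant_harmonic: "x \<in> carrier G \<Longrightarrow> Lap (\<lambda>x. 1) x = 0"
  by (simp add: Lap_def sum_mu)

end

section \<open>Dimension and interpolation\<close>

text \<open>This means that the evaluations at points of \<open>B\<close> are linearly independent
  functionals on \<open>V\<close>; the size of such sets stands in for the dimension.\<close>

definition interpolates :: "('a \<Rightarrow> real) set \<Rightarrow> 'a set \<Rightarrow> bool" where
  "interpolates V B \<longleftrightarrow> finite B \<and> (\<forall>v. \<exists>f\<in>V. \<forall>b\<in>B. f b = v b)"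

lemma interpolates_dual_basis:
  assumes "interpolates V B"
  shows "\<exists>e. \<forall>b. e b \<in> V \<and> (\<forall>b'\<in>B. e b b' = of_bool (b = b'))"
proof (intro choice allI)
  fix b
  show "\<exists>f. f \<in> V \<and> (\<forall>b'\<in>B. f b' = of_bool (b = b'))"
    using assms[unfolded interpolates_def, THEN conjunct2, THEN spec, of "\<lambda>b'. of_bool (b = b')"]
    by blast
qed

text \<open>A multiple of \<open>f\<close> corrects the value at \<open>x\<close> and leaves those
  on \<open>B\<close> alone.\<close>

lemma interpolates_insert:
  assumes sub: "fun_space.subspace V" and B: "interpolates V B"
    and f: "f \<in> V" "\<And>b. b \<in> B \<Longrightarrow> f b = 0" "f x \<noteq> 0"
  shows "interpolates V (insert x B)"
  unfolding interpolates_def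
proof (intro conjI allI)
  show "finite (insert x B)" using B by (simp add: interpolates_def)
  fix v
  obtain g where g: "g \<in> V" "\<And>b. b \<in> B \<Longrightarrow> g b = v b" using B unfolding interpolates_def by blast
  define k where "k = g + (\<lambda>y. (v x - g x) / f x * f y)"
  have "k \<in> V" unfolding k_def
    by (intro fun_space.subspace_add[OF sub] fun_space.subspace_scale[OF sub] g f)
  moreover have "k b = v b" if "b \<in> insert x B" for b
    using that g f by (cases "b = x") (auto simp: k_def)
  ultimately show "\<exists>f\<in>V. \<forall>b\<in>insert x B. f b = v b" by blast
qed

text \<open>If \<open>B\<close> outnumbers a spanning set, the evaluations at \<open>B\<close>
  satisfy a nontrivial relation \<open>c\<close> on \<open>V\<close>. A function in \<open>V\<close>
  with values \<open>c\<close> on \<open>B\<close> turns it into a vanishing sum of squares.\<close>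

lemma fin_dim_bounds_interpolates:
  assumes "fin_dim_fun_space V"
  obtains D where "\<And>B. interpolates V B \<Longrightarrow> card B \<le> D"
proof -
  obtain E where E: "finite E" "E \<subseteq> V" "\<And>f. f \<in> V \<Longrightarrow> \<exists>c. f = (\<lambda>x. \<Sum>b\<in>E. c b * b x)"
    using assms by (auto simp: fin_dim_fun_space_def)
  have "card B \<le> card E" if B: "interpolates V B" for B
  proof (rule ccontr)
    assume "\<not> card B \<le> card E"
    moreover have "finite B" using B by (simp add: interpolates_def)
    ultimately obtain c where c: "\<exists>b\<in>B. c b \<noteq> 0" "\<And>e. e \<in> E \<Longrightarrow> (\<Sum>b\<in>B. c b * e b) = 0"
      using underdetermined_system_nontrivial_solution[OF E(1) \<open>finite B\<close>, of "\<lambda>b e. e b"] by auto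
    obtain f where f: "f \<in> V" "\<And>b. b \<in> B \<Longrightarrow> f b = c b" using B unfolding interpolates_def by blast
    obtain d where d: "f = (\<lambda>x. \<Sum>e\<in>E. d e * e x)" using E f by blast
    have "(\<Sum>b\<in>B. c b * c b) = (\<Sum>b\<in>B. c b * f b)" using f by simp
    also have "\<dots> = (\<Sum>e\<in>E. d e * (\<Sum>b\<in>B. c b * e b))"
      by (simp add: d sum_distrib_left mult_ac sum.swap[of _ B])
    also have "\<dots> = 0" using c by simp
    finally have "\<forall>b\<in>B. c b * c b = 0" using \<open>finite B\<close> by (subst (asm) sum_nonneg_eq_0_iff) auto
    then show False using c by auto
  qed
  then show ?thesis using that by blast
qed

text \<open>A largest interpolating set works, since a function that vanishes on it but not at
  \<open>x\<close> would allow \<open>x\<close> to be added.\<close>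

lemma maximal_interpolates_determines:
  assumes sub: "fun_space.subspace V" and D: "\<And>B. interpolates V B \<Longrightarrow> card B \<le> D"
  shows "\<exists>B. interpolates V B \<and> (\<forall>f\<in>V. (\<forall>b\<in>B. f b = 0) \<longrightarrow> (\<forall>x. f x = 0))"
proof -
  have "interpolates V {}" using fun_space.subspace_0[OF sub] by (auto simp: interpolates_def)
  then have "\<exists>B. interpolates V B \<and> (\<forall>B'. interpolates V B' \<longrightarrow> card B' \<le> card B)"
    using D by (intro ex_has_greatest_nat[of _ _ _ "Suc D"]) (auto simp: less_Suc_eq_le)
  then obtain B where B: "interpolates V B" "\<And>B'. interpolates V B' \<Longrightarrow> card B' \<le> card B"
    by blast
  have "f x = 0" if f: "f \<in> V" "\<And>b. b \<in> B \<Longrightarrow> f b = 0" for f x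
  proof (rule ccontr)
    assume "f x \<noteq> 0"
    then have "card (insert x B) \<le> card B"
      using interpolates_insert[OF sub B(1) f] B(2) by blast
    moreover have "x \<notin> B" "finite B" using f \<open>f x \<noteq> 0\<close> B(1) by (auto simp: interpolates_def)
    ultimately show False by simp
  qed
  then show ?thesis using B(1) by auto
qed

text \<open>The functions dual to a maximal interpolating set span: subtracting the interpolant of
  \<open>f\<close> leaves a function that is 0 on the set, hence everywhere.\<close>

lemma bounded_interpolates_fin_dim:
  assumes sub: "fun_space.subspace V" and D: "\<And>B. interpolates V B \<Longrightarrow> card B \<le> D"
  shows "fin_dim_fun_space V"
proof -
  obtain B where B: "interpolates V B"
    and det: "\<And>f x. f \<in> V \<Longrightarrow> (\<And>b. b \<in> B \<Longrightarrow> f b = 0) \<Longrightarrow> f x = 0"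
    using maximal_interpolates_determines[OF assms] by auto
  have fin: "finite B" using B by (simp add: interpolates_def)
  obtain e where e: "\<And>b. e b \<in> V" "\<And>b b'. b' \<in> B \<Longrightarrow> e b b' = of_bool (b = b')"
    using interpolates_dual_basis[OF B] by auto
  \<comment> \<open>\<open>fin_dim_fun_space\<close> sums over a set of functions, so distinct
    points must give distinct functions before the sum over \<open>B\<close> can be
    reindexed.\<close>
  have inj: "inj_on e B"
  proof (rule inj_onI)
    fix b c assume b: "b \<in> B" and eq: "e b = e c"
    have "e c b = 1" using e(2)[OF b, of b] by (simp only: eq) simp
    then show "b = c" using e(2)[OF b, of c] by (simp split: if_splits)
  qed
  have "\<exists>c. f = (\<lambda>x. \<Sum>g\<in>e ` B. c g * g x)" if f: "f \<in> V" for f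
  proof (intro exI ext)
    fix x
    define k where "k = f - (\<lambda>x. \<Sum>b\<in>B. f b * e b x)"
    have "(\<lambda>x. \<Sum>b\<in>B. f b * e b x) = (\<Sum>b\<in>B. (\<lambda>x. f b * e b x))"
      by (induction B rule: infinite_finite_induct) (auto simp: plus_fun_def fun_eq_iff)
    also have "\<dots> \<in> V"
      by (intro fun_space.subspace_sum[OF sub] fun_space.subspace_scale[OF sub] e)
    finally have "k \<in> V" unfolding k_def by (intro fun_space.subspace_diff[OF sub] f)
    moreover have "k b = 0" if "b \<in> B" for b using e(2) that fin by (simp add: k_def sum_mult_of_bool_eq_single)
    ultimately have "k x = 0" by (rule det)
    then have "f x = (\<Sum>b\<in>B. f b * e b x)" by (simp add: k_def)
    also have "\<dots> = (\<Sum>g\<in>e ` B. f (inv_into B e g) * g x)"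
      using inj by (subst sum.reindex) (auto intro!: sum.cong)
    finally show "f x = (\<Sum>g\<in>e ` B. f (inv_into B e g) * g x)" .
  qed
  then show ?thesis unfolding fin_dim_fun_space_def
    using fin e(1) by (intro exI[of _ "e ` B"]) auto
qed

section \<open>A cyclic subgroup of finite index bounds the dimension\<close>

context symmetric_walk
begin

lemma subspace_H: "fun_space.subspace H"
  by (auto simp: fun_space.subspace_def H_iff Lap_add Lap_scale Lap_zero plus_fun_def zero_fun_def)

lemma interpolates_H_carrier:
  assumes "interpolates H B" shows "B \<subseteq> carrier G"
proof
  fix b assume "b \<in> B"
  moreover obtain f where "f \<in> H" "\<forall>b\<in>B. f b = 1"
    using assms[unfolded interpolates_def, THEN conjunct2, THEN spec, of "\<lambda>_. 1"] by auto
  ultimately show "b \<in> carrier G" by (auto simp: H_iff)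
qed

definition outer_boundary :: "'a set \<Rightarrow> 'a set" where
  "outer_boundary W = (\<lambda>(w, s). w \<otimes> s) ` (W \<times> S) - W"

text \<open>By the maximum principle a harmonic function on \<open>W\<close> is determined by its values on the outer
  boundary of \<open>W\<close>, so these boundary sizes bound the dimension.\<close>

lemma interpolates_card_le_boundary:
  assumes B: "interpolates H B" and W: "finite W" "B \<subseteq> W" "W \<subseteq> carrier G"
  shows "card B \<le> card (outer_boundary W)"
proof (rule ccontr)
  have fin: "finite B" using B by (simp add: interpolates_def)
  obtain e where e: "\<And>b. e b \<in> H" "\<And>b b'. b' \<in> B \<Longrightarrow> e b b' = of_bool (b = b')"
    using interpolates_dual_basis[OF B] by auto
  assume "\<not> card B \<le> card (outer_boundary W)"
  then have "card (outer_boundary W) < card B" by simp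
  moreover have "finite (outer_boundary W)" using W finite_S by (auto simp: outer_boundary_def)
  \<comment> \<open>Vanishing on the outer boundary imposes fewer conditions than there are dual
    functions to combine.\<close>
  ultimately obtain c where c: "\<exists>b\<in>B. c b \<noteq> 0"
    "\<And>x. x \<in> outer_boundary W \<Longrightarrow> (\<Sum>b\<in>B. c b * e b x) = 0"
    using underdetermined_system_nontrivial_solution[OF _ fin, of _ e] by blast
  define h where "h = (\<lambda>x. \<Sum>b\<in>B. c b * e b x)"
  have Lh: "Lap h x = 0" for x using e(1) by (simp add: h_def Lap_sum H_iff)
  define f where "f = (\<lambda>x. if x \<in> W then h x else 0)"
  have "f = (\<lambda>x. 0)"
  proof (rule maximum_principle[OF W(1,3)])
    fix x assume x: "x \<in> W"
    \<comment> \<open>A neighbour of \<open>x\<close> outside \<open>W\<close> lies on the outer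
      boundary, where \<open>h\<close> is 0, so the cutoff \<open>f\<close> agrees with
      \<open>h\<close> there as well.\<close>
    have "f (x \<otimes> s) = h (x \<otimes> s)" if "s \<in> S" for s
      using c(2)[of "x \<otimes> s"] x that by (force simp: f_def h_def outer_boundary_def)
    then have "Lap f x = Lap h x" using x W by (auto simp: Lap_def f_def)
    then show "Lap f x = 0" by (simp add: Lh)
  qed (simp add: f_def)
  then have h0: "h x = 0" if "x \<in> W" for x using that by (auto simp: f_def fun_eq_iff split: if_splits)
  have "c b = 0" if b: "b \<in> B" for b
  proof -
    have "h b = (\<Sum>a\<in>B. c a * of_bool (a = b))" using b by (simp add: h_def e)
    also have "\<dots> = c b" using b fin by (simp add: sum_mult_of_bool_eq_single)
    finally show ?thesis using h0 b W by auto
  qed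
  then show False using c by blast
qed

text \<open>Powers of \<open>t\<close> stand on the left and steps act on the right, so a step
  shifts the exponent by an amount depending only on the representative and on \<open>s\<close>.
  Hence one size bound serves the boundaries of all slabs.\<close>

lemma fin_dim_if_covered_by_cyclic_translates:
  assumes t: "t \<in> carrier G" and R: "finite R" "R \<subseteq> carrier G"
    and cover: "\<And>x. x \<in> carrier G \<Longrightarrow> \<exists>i::int. \<exists>r\<in>R. x = t [^] i \<otimes> r"
  shows "fin_dim_fun_space H"
proof -
  define slab where "slab n = (\<lambda>(i::int, r). t [^] i \<otimes> r) ` ({-n..n} \<times> R)" for n
  have "\<exists>i::int. \<exists>q\<in>R. r \<otimes> s = t [^] i \<otimes> q" if "r \<in> R" "s \<in> S" for r s
    using cover[of "r \<otimes> s"] that R S_carrier by auto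
  then obtain m \<rho> where m: "\<And>r s. r \<in> R \<Longrightarrow> s \<in> S \<Longrightarrow>
      \<rho> r s \<in> R \<and> r \<otimes> s = t [^] (m r s :: int) \<otimes> \<rho> r s"
    by metis
  define M where "M = (\<Sum>(r,s)\<in>R \<times> S. \<bar>m r s\<bar>)"
  have mM: "\<bar>m r s\<bar> \<le> M" if "r \<in> R" "s \<in> S" for r s
    unfolding M_def using member_le_sum[of "(r,s)" "R \<times> S" "\<lambda>(r,s). \<bar>m r s\<bar>"] that R finite_S by auto
  have M0: "M \<ge> 0" unfolding M_def by (rule sum_nonneg) auto
  have bd: "card (outer_boundary (slab n)) \<le> nat (2 * M) * card R" for n
  proof -
    \<comment> \<open>\<open>J\<close> holds the \<open>M\<close> exponents beyond each end of the
      slab, as far as one step can lead.\<close>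
    define J where "J = {n<..n+M} \<union> {-n-M..<-n}"
    have "card J \<le> card {n<..n+M} + card {-n-M..<-n}" unfolding J_def by (rule card_Un_le)
    also have "\<dots> = nat (2 * M)" using M0 by auto
    finally have J: "card J \<le> nat (2 * M)" "finite J" by (auto simp: J_def)
    have "outer_boundary (slab n) \<subseteq> (\<lambda>(i::int, r). t [^] i \<otimes> r) ` (J \<times> R)"
    proof
      fix x assume x: "x \<in> outer_boundary (slab n)"
      then obtain i r s where i: "i \<in> {-n..n}" and r: "r \<in> R" and s: "s \<in> S"
        and xe: "x = t [^] i \<otimes> r \<otimes> s" and xn: "x \<notin> slab n"
        by (auto simp: outer_boundary_def slab_def)
      have mem: "r \<in> carrier G" "s \<in> carrier G" "\<rho> r s \<in> carrier G" using r s R m S_carrier by blast+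
      have "x = t [^] i \<otimes> (t [^] m r s \<otimes> \<rho> r s)"
        using xe m[OF r s] mem t by (simp add: m_assoc)
      also have "\<dots> = t [^] (i + m r s) \<otimes> \<rho> r s" using t mem by (simp add: int_pow_mult m_assoc)
      finally have eq: "x = t [^] (i + m r s) \<otimes> \<rho> r s" .
      have "i + m r s \<notin> {-n..n}"
        using xn eq m[OF r s] by (force simp: slab_def)
      moreover have "i + m r s \<in> {-n-M..n+M}" using i mM[OF r s] by auto
      ultimately have "i + m r s \<in> J" by (auto simp: J_def)
      then show "x \<in> (\<lambda>(i::int, r). t [^] i \<otimes> r) ` (J \<times> R)" using eq m[OF r s] by force
    qed
    then have "card (outer_boundary (slab n)) \<le> card ((\<lambda>(i::int, r). t [^] i \<otimes> r) ` (J \<times> R))"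
      using J R by (intro card_mono) auto
    also have "\<dots> \<le> card (J \<times> R)" using J R by (intro card_image_le) auto
    also have "\<dots> \<le> nat (2 * M) * card R" using J by (simp add: card_cartesian_product)
    finally show ?thesis .
  qed
  have "card B \<le> nat (2 * M) * card R" if B: "interpolates H B" for B
  proof -
    have fin: "finite B" and sub: "B \<subseteq> carrier G"
      using B interpolates_H_carrier by (auto simp: interpolates_def)
    obtain i q where i: "\<And>b. b \<in> B \<Longrightarrow> q b \<in> R \<and> b = t [^] (i b :: int) \<otimes> q b"
      using cover sub by (metis subsetD)
    define n where "n = (\<Sum>b\<in>B. \<bar>i b\<bar>)"
    have "\<bar>i b\<bar> \<le> n" if "b \<in> B" for b
      unfolding n_def using member_le_sum[of b B "\<lambda>b. \<bar>i b\<bar>"] that fin by auto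
    then have "i b \<in> {-n..n}" if "b \<in> B" for b using that by force
    then have "B \<subseteq> slab n" unfolding slab_def using i by force
    moreover have "finite (slab n)" "slab n \<subseteq> carrier G" using R t by (auto simp: slab_def)
    ultimately show ?thesis using interpolates_card_le_boundary[OF B] bd[of n] le_trans by blast
  qed
  then show ?thesis by (rule bounded_interpolates_fin_dim[OF subspace_H])
qed

text \<open>\<open>t\<close> is the image of 1 and \<open>R\<close> picks coset representatives.
  With cosets of the form \<open>K #> x\<close> the power of \<open>t\<close> comes out on the left,
  as the covering lemma requires.\<close>

lemma fin_dim_if_virtually_Z:
  assumes K: "subgroup K G" "finite (rcosets K)" "G\<lparr>carrier := K\<rparr> \<cong> integer_group"
  shows "fin_dim_fun_space H"
proof -
  interpret KG: group "G\<lparr>carrier := K\<rparr>" by (rule subgroup_imp_group[OF K(1)])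
  have "integer_group \<cong> G\<lparr>carrier := K\<rparr>" using KG.iso_sym K(3) by blast
  then obtain \<phi> where \<phi>: "\<phi> \<in> iso integer_group (G\<lparr>carrier := K\<rparr>)" by (auto simp: is_iso_def)
  then have hom: "\<phi> \<in> hom integer_group (G\<lparr>carrier := K\<rparr>)" and im: "\<phi> ` UNIV = K"
    by (auto simp: iso_def bij_betw_def)
  define t where "t = \<phi> 1"
  have tK: "t \<in> K" using im by (auto simp: t_def)
  then have t: "t \<in> carrier G" by (rule subgroup.mem_carrier[OF K(1)])
  have \<phi>_eq: "\<phi> i = t [^] i" for i :: int
  proof -
    interpret hm: group_hom integer_group "G\<lparr>carrier := K\<rparr>" \<phi>
      using hom by (intro group_hom.intro group_hom_axioms.intro group_integer_group KG.group_axioms)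
    have "\<phi> i = \<phi> (1 [^]\<^bsub>integer_group\<^esub> i)" by simp
    also have "\<dots> = t [^]\<^bsub>G\<lparr>carrier := K\<rparr>\<^esub> i" using hm.hom_int_pow[of 1 i] by (simp add: t_def)
    also have "\<dots> = t [^] i" using int_pow_consistent[OF K(1) tK] by simp
    finally show ?thesis .
  qed
  define R where "R = (\<lambda>C. SOME x. x \<in> C) ` (rcosets K)"
  have C: "(SOME x. x \<in> C) \<in> C \<and> C \<subseteq> carrier G" if "C \<in> rcosets K" for C
  proof -
    from that obtain x where "x \<in> carrier G" "C = K #> x" by (auto simp: RCOSETS_def)
    then have "x \<in> C" "C \<subseteq> carrier G"
      using rcos_self[OF _ K(1)] r_coset_subset_G[OF subgroup.subset[OF K(1)]] by auto
    then show ?thesis by (auto intro: someI)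
  qed
  have "\<exists>i::int. \<exists>r\<in>R. x = t [^] i \<otimes> r" if x: "x \<in> carrier G" for x
  proof -
    have cos: "K #> x \<in> rcosets K" using x by (auto simp: RCOSETS_def)
    define r where "r = (SOME y. y \<in> K #> x)"
    have "r \<in> R" using cos by (auto simp: R_def r_def)
    moreover have "r \<in> K #> x" using C[OF cos] by (simp add: r_def)
    then have "K #> x = K #> r" using repr_independence[OF _ x K(1)] by simp
    then have "x \<in> K #> r" using rcos_self[OF x K(1)] by simp
    then obtain k where "k \<in> K" "x = k \<otimes> r" by (auto simp: r_coset_def)
    moreover obtain i where "k = t [^] (i::int)" using \<open>k \<in> K\<close> im \<phi>_eq by auto
    ultimately show ?thesis by blast
  qed
  then show ?thesis
    by (intro fin_dim_if_covered_by_cyclic_translates[OF t, of R]) (use K C in \<open>auto simp: R_def\<close>)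
qed

end

section \<open>Green functions and cuts\<close>

context symmetric_walk
begin

lemma Lap_cong_carrier:
  assumes "\<And>x. x \<in> carrier G \<Longrightarrow> f x = g x" shows "Lap f = Lap g"
  using assms S_carrier by (auto simp: Lap_def fun_eq_iff intro!: sum.cong)

text \<open>Both endpoints of an edge between \<open>A\<close> and its complement belong to it, in
  contrast to \<open>outer_boundary\<close>; so a set and its complement have the same
  boundary.\<close>

definition bdry :: "'a set \<Rightarrow> 'a set" where
  "bdry A = {x \<in> carrier G. \<exists>s\<in>S. (x \<in> A) \<noteq> (x \<otimes> s \<in> A)}"

text \<open>Equivalently, right translation by each element of \<open>S\<close> changes
  \<open>A\<close> in finitely many points. Such sets describe the ends of the group.\<close>

definition almost_inv :: "'a set \<Rightarrow> bool" where
  "almost_inv A \<longleftrightarrow> A \<subseteq> carrier G \<and> finite (bdry A)"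

lemma finsup_Lap_indicator:
  assumes "almost_inv A" shows "Lap (\<lambda>x. of_bool (x \<in> A)) \<in> finsup"
proof (rule finsupI[of "bdry A"])
  fix x assume x: "x \<notin> bdry A"
  show "Lap (\<lambda>x. of_bool (x \<in> A)) x = 0"
  proof (cases "x \<in> carrier G")
    case True
    then have "(\<Sum>s\<in>S. \<mu> s * of_bool (x \<otimes> s \<in> A)) = (\<Sum>s\<in>S. \<mu> s * of_bool (x \<in> A))"
      using x by (intro sum.cong) (auto simp: bdry_def)
    also have "\<dots> = of_bool (x \<in> A)" by (simp add: sum_mu flip: sum_distrib_right)
    finally show ?thesis by (simp add: Lap_def)
  qed (simp add: Lap_def)
qed (use assms in \<open>auto simp: almost_inv_def bdry_def\<close>)

text \<open>Edges of the Cayley graph after deletion of the vertices in \<open>K\<close>; the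
  closure \<open>(adj K)\<^sup>*\<close> yields its components.\<close>

definition adj :: "'a set \<Rightarrow> ('a \<times> 'a) set" where
  "adj K = {(p, q). p \<in> carrier G - K \<and> q \<in> carrier G - K \<and> (\<exists>s\<in>S. q = p \<otimes> s)}"

lemma adj_sym: "(p, q) \<in> adj K \<Longrightarrow> (q, p) \<in> adj K"
proof -
  assume "(p, q) \<in> adj K"
  then obtain s where s: "p \<in> carrier G - K" "q \<in> carrier G - K" "s \<in> S" "q = p \<otimes> s"
    by (auto simp: adj_def)
  then have "p = q \<otimes> inv s" using S_carrier by (simp add: m_assoc)
  then show "(q, p) \<in> adj K" using s S_inv by (auto simp: adj_def)
qed

lemma adj_rtrancl_sym: "(p, q) \<in> (adj K)\<^sup>* \<Longrightarrow> (q, p) \<in> (adj K)\<^sup>*"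
  by (induction rule: rtrancl_induct) (auto intro: adj_sym converse_rtrancl_into_rtrancl)

lemma adj_rtrancl_outside: "(p, q) \<in> (adj K)\<^sup>* \<Longrightarrow> p \<in> carrier G - K \<Longrightarrow> q \<in> carrier G - K"
  by (induction rule: rtrancl_induct) (auto simp: adj_def)

text \<open>An edge leaving the component has an endpoint in \<open>K\<close>, and only finitely
  many edges touch \<open>K\<close>.\<close>

lemma almost_inv_component:
  assumes K: "finite K" "K \<subseteq> carrier G" and p: "p \<in> carrier G - K"
  shows "almost_inv ((adj K)\<^sup>* `` {p})"
proof -
  let ?A = "(adj K)\<^sup>* `` {p}"
  have A: "?A \<subseteq> carrier G - K" using adj_rtrancl_outside p by blast
  have "bdry ?A \<subseteq> K \<union> (\<lambda>(k, s). k \<otimes> inv s) ` (K \<times> S)"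
  proof
    fix x assume "x \<in> bdry ?A"
    then obtain s where x: "x \<in> carrier G" and s: "s \<in> S" and ne: "(x \<in> ?A) \<noteq> (x \<otimes> s \<in> ?A)"
      by (auto simp: bdry_def)
    have xs: "x \<otimes> s \<in> carrier G" using x s S_carrier by auto
    have "(x \<in> ?A) = (x \<otimes> s \<in> ?A)" if "x \<notin> K" "x \<otimes> s \<notin> K"
    proof -
      have "(x, x \<otimes> s) \<in> adj K" using that x xs s by (auto simp: adj_def)
      with adj_sym[OF this] show ?thesis by (auto intro: rtrancl_into_rtrancl)
    qed
    then have "x \<in> K \<or> x \<otimes> s \<in> K" using ne by blast
    moreover have "x = x \<otimes> s \<otimes> inv s" using x s S_carrier by (simp add: m_assoc)
    ultimately show "x \<in> K \<union> (\<lambda>(k, s). k \<otimes> inv s) ` (K \<times> S)" using s by force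
  qed
  then have "finite (bdry ?A)" by (rule finite_subset) (use K finite_S in auto)
  then show ?thesis using A by (auto simp: almost_inv_def)
qed

text \<open>A component without neighbours in \<open>K\<close> would be closed under steps, hence
  all of \<open>G\<close>, yet it misses the nonempty \<open>K\<close>. So every component meets the
  finite set of points next to \<open>K\<close>.\<close>

lemma finite_union_finite_components:
  assumes K: "finite K" "K \<subseteq> carrier G" "K \<noteq> {}"
  shows "finite {p \<in> carrier G - K. finite ((adj K)\<^sup>* `` {p})}"
proof -
  define Z where "Z = {z \<in> (\<lambda>(k, s). k \<otimes> inv s) ` (K \<times> S). finite ((adj K)\<^sup>* `` {z})}"
  have "{p \<in> carrier G - K. finite ((adj K)\<^sup>* `` {p})} \<subseteq> (\<Union>z\<in>Z. (adj K)\<^sup>* `` {z})"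
  proof
    fix p assume "p \<in> {p \<in> carrier G - K. finite ((adj K)\<^sup>* `` {p})}"
    then have p: "p \<in> carrier G - K" and fin: "finite ((adj K)\<^sup>* `` {p})" by auto
    have "\<exists>z s. (p, z) \<in> (adj K)\<^sup>* \<and> s \<in> S \<and> z \<otimes> s \<in> K"
    proof (rule ccontr)
      assume no: "\<not> ?thesis"
      have "(adj K)\<^sup>* `` {p} = carrier G"
      proof (rule step_closed_eq_carrier)
        show "(adj K)\<^sup>* `` {p} \<subseteq> carrier G" using adj_rtrancl_outside p by blast
        show "(adj K)\<^sup>* `` {p} \<noteq> {}" by auto
        fix z s assume z: "z \<in> (adj K)\<^sup>* `` {p}" and s: "s \<in> S"
        then have "z \<in> carrier G - K" using adj_rtrancl_outside p by blast
        moreover have "z \<otimes> s \<notin> K" using no z s by blast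
        ultimately have "(z, z \<otimes> s) \<in> adj K" using s S_carrier by (auto simp: adj_def)
        then show "z \<otimes> s \<in> (adj K)\<^sup>* `` {p}" using z by (auto intro: rtrancl_into_rtrancl)
      qed
      then show False using K adj_rtrancl_outside p by blast
    qed
    then obtain z s where z: "(p, z) \<in> (adj K)\<^sup>*" "s \<in> S" "z \<otimes> s \<in> K" by blast
    have "z \<in> carrier G" using adj_rtrancl_outside[OF z(1) p] by blast
    then have "z = z \<otimes> s \<otimes> inv s" using z S_carrier by (simp add: m_assoc)
    moreover have "finite ((adj K)\<^sup>* `` {z})"
      by (rule finite_subset[OF _ fin]) (use z in \<open>auto intro: rtrancl_trans\<close>)
    ultimately have "z \<in> Z" using z by (force simp: Z_def)
    then show "p \<in> (\<Union>z\<in>Z. (adj K)\<^sup>* `` {z})" using adj_rtrancl_sym[OF z(1)] by blast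
  qed
  moreover have "finite (\<Union>z\<in>Z. (adj K)\<^sup>* `` {z})"
    using K finite_S by (intro finite_UN_I) (auto simp: Z_def)
  ultimately show ?thesis by (rule finite_subset)
qed

end

section \<open>Green functions with correction terms on a finite set\<close>

locale finite_dim_walk = symmetric_walk G \<mu> for G (structure) and \<mu> :: "'a \<Rightarrow> real" +
  fixes B :: "'a set"
  assumes B_interpolates: "interpolates H B"
    and B_determines: "\<forall>h\<in>H. (\<forall>b\<in>B. h b = 0) \<longrightarrow> (\<forall>x. h x = 0)"
begin

lemma finite_B: "finite B"
  using B_interpolates by (simp add: interpolates_def)

lemma B_carrier: "B \<subseteq> carrier G"
  using B_interpolates by (rule interpolates_H_carrier)

text \<open>Duality: a functional on functions that kills the image of the Laplacian is, by symmetry of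
  \<open>\<mu>\<close>, a harmonic function, and one that also kills all deltas in \<open>B\<close> vanishes.\<close>

lemma delta_eq_Lap_outside_B:
  assumes x: "x \<in> carrier G"
  shows "\<exists>\<phi>. \<phi> \<in> finsup \<and> (\<forall>y. y \<notin> B \<longrightarrow> Lap \<phi> y = delta x y)"
proof -
  define W where "W = (\<lambda>y. Lap (delta y)) ` carrier G \<union> delta ` B"
  define U where "U = {f. \<exists>\<phi>. \<phi> \<in> finsup \<and> (\<forall>y. y \<notin> B \<longrightarrow> Lap \<phi> y = f y)}"
  have "delta x \<in> fun_space.span W"
  proof (rule ccontr)
    assume "delta x \<notin> fun_space.span W"
    then obtain F :: "('a \<Rightarrow> real) \<Rightarrow> real"
      where add: "\<And>g h. F (\<lambda>x. g x + h x) = F g + F h"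
        and scale: "\<And>c g. F (\<lambda>x. c * g x) = c * F g"
        and W: "\<And>g. g \<in> W \<Longrightarrow> F g = 0" and Fx: "F (delta x) = 1"
      using functional_separating_span[of "delta x" W] by blast
    have F0: "F (\<lambda>x. 0) = 0" using scale[of 0 "\<lambda>x. 0"] by simp
    have Fsum: "F (\<lambda>x. \<Sum>i\<in>I. c i * g i x) = (\<Sum>i\<in>I. c i * F (g i))" for I :: "'a set" and c g
      by (induction I rule: infinite_finite_induct) (simp_all add: F0 add scale)
    define h where "h y = (if y \<in> carrier G then F (delta y) else 0)" for y
    have "Lap h y = 0" for y
    proof (cases "y \<in> carrier G")
      case True
      have "Lap (delta y) = (\<lambda>z. delta y z + (-1) * (\<Sum>s\<in>S. \<mu> s * delta (y \<otimes> s) z))"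
        using Lap_delta[OF True] by simp
      then have "F (Lap (delta y)) = F (delta y) + (-1) * (\<Sum>s\<in>S. \<mu> s * F (delta (y \<otimes> s)))"
        by (simp only: add scale Fsum)
      moreover have "F (Lap (delta y)) = 0" using W True by (auto simp: W_def)
      ultimately show ?thesis using True S_carrier by (simp add: Lap_def h_def)
    qed (simp add: Lap_def)
    then have "h \<in> H" by (auto simp: H_iff h_def)
    moreover have "h b = 0" if "b \<in> B" for b using W that B_carrier by (auto simp: h_def W_def)
    ultimately have "h x = 0" using B_determines by blast
    then show False using Fx x by (simp add: h_def)
  qed
  moreover have "fun_space.subspace U"
    unfolding fun_space.subspace_def
  proof (intro conjI allI ballI)
    show "0 \<in> U" using finsup_zero by (auto simp: U_def Lap_zero intro!: exI[of _ "\<lambda>x. 0"])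
    fix f assume "f \<in> U"
    then obtain \<phi> where \<phi>: "\<phi> \<in> finsup" "\<And>y. y \<notin> B \<Longrightarrow> Lap \<phi> y = f y" by (auto simp: U_def)
    show "(\<lambda>x. c * f x) \<in> U" for c
      unfolding U_def using \<phi> by (auto simp: Lap_scale finsup_scale intro!: exI[of _ "\<lambda>x. c * \<phi> x"])
    fix g assume "g \<in> U"
    then obtain \<psi> where \<psi>: "\<psi> \<in> finsup" "\<And>y. y \<notin> B \<Longrightarrow> Lap \<psi> y = g y" by (auto simp: U_def)
    show "f + g \<in> U"
      unfolding U_def using \<phi> \<psi> by (auto simp: Lap_add finsup_add intro!: exI[of _ "\<lambda>x. \<phi> x + \<psi> x"])
  qed
  moreover have "Lap (delta y) \<in> U" if "y \<in> carrier G" for y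
    unfolding U_def using finsup_delta[OF that] by blast
  moreover have "delta b \<in> U" if "b \<in> B" for b
    unfolding U_def using finsup_zero that by (auto simp: Lap_zero intro!: exI[of _ "\<lambda>x. 0"])
  ultimately have "delta x \<in> U"
    using fun_space.span_minimal[of W U] by (auto simp: W_def)
  then show ?thesis by (simp add: U_def)
qed

text \<open>Pairing \<open>f\<close> with a harmonic function that interpolates \<open>Lap f\<close>
  on \<open>B\<close> gives a sum of squares, which is 0 by summation by parts.\<close>

lemma Lap_supported_on_B_zero:
  assumes f: "f \<in> finsup" and B: "\<And>y. y \<notin> B \<Longrightarrow> Lap f y = 0"
  shows "f = (\<lambda>x. 0)"
proof -
  obtain h where h: "h \<in> H" "\<forall>b\<in>B. h b = Lap f b"
    using B_interpolates[unfolded interpolates_def, THEN conjunct2, THEN spec, of "Lap f"] by blast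
  have "(\<Sum>x\<in>B. h x * Lap f x) = 0"
    by (rule sum_harmonic_Lap) (use h f B finite_B in \<open>auto simp: H_iff\<close>)
  then have "(\<Sum>x\<in>B. Lap f x * Lap f x) = 0" using h by simp
  then have "Lap f x = 0" if "x \<in> B" for x
    using that finite_B by (subst (asm) sum_nonneg_eq_0_iff) auto
  then have "Lap f = (\<lambda>x. 0)" using B by blast
  then show ?thesis using f by (rule Lap_finsup_inj[rotated])
qed

text \<open>The finitely supported potential of a unit mass at \<open>x\<close>, with arbitrary
  compensating masses allowed on \<open>B\<close>. By \<open>green_unique\<close> the choice is
  unique, and it is 0 for \<open>x\<close> in \<open>B\<close>.\<close>

definition green :: "'a \<Rightarrow> 'a \<Rightarrow> real" where
  "green x = (SOME \<phi>. \<phi> \<in> finsup \<and> (\<forall>y. y \<notin> B \<longrightarrow> Lap \<phi> y = delta x y))"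

lemma finsup_green: "x \<in> carrier G \<Longrightarrow> green x \<in> finsup"
  and Lap_green: "x \<in> carrier G \<Longrightarrow> y \<notin> B \<Longrightarrow> Lap (green x) y = delta x y"
  using someI_ex[OF delta_eq_Lap_outside_B] unfolding green_def by auto

lemma green_unique:
  assumes x: "x \<in> carrier G" and f: "f \<in> finsup" and eq: "\<And>y. y \<notin> B \<Longrightarrow> Lap f y = delta x y"
  shows "f = green x"
proof -
  have "(\<lambda>y. f y - green x y) = (\<lambda>x. 0)"
    by (rule Lap_supported_on_B_zero) (use assms in \<open>auto simp: Lap_diff finsup_diff finsup_green Lap_green\<close>)
  then show ?thesis by (simp add: fun_eq_iff)
qed

lemma finsup_eq_Lap_outside_B:
  assumes f: "f \<in> finsup"
  shows "\<exists>\<phi>. \<phi> \<in> finsup \<and> (\<forall>y. y \<notin> B \<longrightarrow> Lap \<phi> y = f y)"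
proof (intro exI conjI allI impI)
  let ?P = "{x. f x \<noteq> 0}"
  have P: "?P \<subseteq> carrier G" using f by (simp add: finsup_def)
  show "(\<lambda>x. \<Sum>y\<in>?P. f y * green y x) \<in> finsup"
    using P finsup_green by (intro finsup_sum) blast
  fix y assume "y \<notin> B"
  then have "Lap (\<lambda>x. \<Sum>y\<in>?P. f y * green y x) y = (\<Sum>z\<in>?P. f z * delta z y)"
    unfolding Lap_sum using P by (intro sum.cong) (auto simp: Lap_green)
  then show "Lap (\<lambda>x. \<Sum>y\<in>?P. f y * green y x) y = f y"
    using finsup_eq_sum_delta[OF f] by metis
qed

text \<open>Translating \<open>green x\<close> by \<open>g\<close> also moves its compensating
  masses from \<open>B\<close> to \<open>g B\<close>; adding multiples of the
  \<open>green (g \<otimes> b)\<close> repairs this, and by uniqueness the result is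
  \<open>green (g \<otimes> x)\<close>.\<close>

lemma green_translate_support:
  assumes g: "g \<in> carrier G" and x: "x \<in> carrier G" and y: "y \<in> carrier G"
    and ne: "green (g \<otimes> x) y \<noteq> 0"
  shows "green x (inv g \<otimes> y) \<noteq> 0 \<or> (\<exists>b\<in>B. green (g \<otimes> b) y \<noteq> 0)"
proof -
  \<comment> \<open>The deviation of \<open>Lap (green x)\<close> from the unit mass; it vanishes
    off \<open>B\<close>.\<close>
  define r where "r b = delta x b - Lap (green x) b" for b
  define \<psi> where "\<psi> = (\<lambda>z. if z \<in> carrier G then green x (inv g \<otimes> z) else 0)"
  define f where "f = (\<lambda>z. \<psi> z + (\<Sum>b\<in>B. r b * green (g \<otimes> b) z))"
  have gb: "g \<otimes> b \<in> carrier G" if "b \<in> B" for b using that g B_carrier by auto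
  have Lf: "Lap f z = delta (g \<otimes> x) z" if z: "z \<notin> B" for z
  proof (cases "z \<in> carrier G")
    case True
    let ?w = "inv g \<otimes> z"
    have "(z = g \<otimes> b) = (b = ?w)" if "b \<in> carrier G" for b
      using g True that inv_solve_left by auto
    note shift = this
    have "Lap \<psi> z = Lap (\<lambda>z. green x (inv g \<otimes> z)) z"
      by (rule fun_cong[OF Lap_cong_carrier]) (simp add: \<psi>_def)
    also have "\<dots> = Lap (green x) ?w" using g True by (rule Lap_translate)
    finally have 1: "Lap \<psi> z = Lap (green x) ?w" .
    have "(\<Sum>b\<in>B. r b * Lap (green (g \<otimes> b)) z) = (\<Sum>b\<in>B. r b * of_bool (b = ?w))"
      using z B_carrier by (intro sum.cong refl) (auto simp: Lap_green gb shift subset_iff)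
    also have "\<dots> = (if ?w \<in> B then r ?w else 0)"
      using finite_B by (rule sum_mult_of_bool_eq_single)
    also have "\<dots> = r ?w" using Lap_green[OF x] by (auto simp: r_def)
    finally have "Lap f z = delta x ?w" by (simp add: f_def Lap_add Lap_sum 1 r_def)
    then show ?thesis using shift[OF x] by (simp add: eq_commute[of x])
  next
    case False
    then show ?thesis using g x by (auto simp: Lap_def)
  qed
  have "f \<in> finsup" unfolding f_def \<psi>_def
    using finsup_translate[OF finsup_green[OF x] g] gb finsup_green
    by (intro finsup_add finsup_sum) auto
  then have "f = green (g \<otimes> x)" using g x Lf by (intro green_unique) auto
  then have "f y \<noteq> 0" using ne by simp
  then have "green x (inv g \<otimes> y) \<noteq> 0 \<or> (\<Sum>b\<in>B. r b * green (g \<otimes> b) y) \<noteq> 0"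
    using y by (auto simp: f_def \<psi>_def)
  then show ?thesis by (metis (no_types, lifting) mult_zero_right sum.neutral)
qed

text \<open>Otherwise the support splits into a cluster near \<open>\<one>\<close> and one near
  \<open>x\<close>. For distant \<open>x\<close> these do not interact, and the second alone would
  have the unit mass at \<open>x\<close> as its Laplacian.\<close>

lemma green_support_meets_far:
  assumes N: "finite N"
  shows "\<exists>x\<in>carrier G. \<exists>y\<in>carrier G. green x y \<noteq> 0 \<and> inv y \<notin> N \<and> inv y \<otimes> x \<notin> N"
proof (rule ccontr)
  assume no: "\<not> ?thesis"
  \<comment> \<open>\<open>P\<close> is the cluster near \<open>\<one>\<close>, enlarged by
    \<open>B\<close>, and its translate by \<open>x\<close> is the other one. \<open>Q\<close> adds
    neighbours, and \<open>x\<close> is chosen so that \<open>Q\<close> and its translate are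
    disjoint.\<close>
  define P where "P = (\<lambda>n. inv n) ` (N \<inter> carrier G) \<union> B \<union> {\<one>}"
  have P: "finite P" "P \<subseteq> carrier G" using N finite_B B_carrier by (auto simp: P_def)
  define Q where "Q = P \<union> (\<lambda>(p, s). p \<otimes> inv s) ` (P \<times> S)"
  have Q: "finite Q" "Q \<subseteq> carrier G" using P finite_S S_carrier by (auto simp: Q_def)
  have "finite ((\<lambda>(p, q). p \<otimes> inv q) ` (Q \<times> Q))" using Q by auto
  then obtain x where x: "x \<in> carrier G" and xQ: "x \<notin> (\<lambda>(p, q). p \<otimes> inv q) ` (Q \<times> Q)"
    using infinite_carrier by (meson finite_subset subsetI)
  have disj: "x \<otimes> q \<notin> Q" if q: "q \<in> Q" for q
  proof
    assume "x \<otimes> q \<in> Q"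
    moreover have "x = x \<otimes> q \<otimes> inv q" using x q Q by (auto simp: m_assoc)
    ultimately show False using xQ q by force
  qed
  have QI: "z \<in> Q" if "z \<in> carrier G" "s \<in> S" "z \<otimes> s \<in> P" for z s
  proof -
    have "z = z \<otimes> s \<otimes> inv s" using that S_carrier by (simp add: m_assoc)
    then show ?thesis using that by (force simp: Q_def)
  qed
  define xP where "xP = (\<lambda>p. x \<otimes> p) ` P"
  define xQ where "xQ = (\<lambda>p. x \<otimes> p) ` Q"
  have sub: "xP \<subseteq> xQ" "P \<subseteq> Q" by (auto simp: xP_def xQ_def Q_def)
  have xQI: "z \<in> xQ" if z: "z \<in> carrier G" "s \<in> S" "z \<otimes> s \<in> xP" for z s
  proof -
    obtain p where p: "p \<in> P" "z \<otimes> s = x \<otimes> p" using z by (auto simp: xP_def)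
    have pG: "p \<in> carrier G" and sG: "s \<in> carrier G" using p P z S_carrier by auto
    have "z = z \<otimes> s \<otimes> inv s" using z sG by (simp add: m_assoc)
    also have "\<dots> = x \<otimes> (p \<otimes> inv s)" using p x pG sG by (simp add: m_assoc)
    finally have "z = x \<otimes> (p \<otimes> inv s)" .
    moreover have "p \<otimes> inv s \<in> Q" using p z by (force simp: Q_def)
    ultimately show ?thesis by (auto simp: xQ_def)
  qed
  have supp: "z \<in> P \<union> xP" if "green x z \<noteq> 0" for z
  proof -
    have z: "z \<in> carrier G" using finsup_green[OF x] that by (auto simp: finsup_def)
    then have "inv z \<in> N \<or> inv z \<otimes> x \<in> N" using no x that by blast
    then show ?thesis
    proof
      assume "inv z \<in> N"
      then have "z \<in> P" using z by (force simp: P_def)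
      then show ?thesis by simp
    next
      assume "inv z \<otimes> x \<in> N"
      then have "inv (inv z \<otimes> x) \<in> P" using x z by (auto simp: P_def)
      moreover have "x \<otimes> inv (inv z \<otimes> x) = z" using x z by (simp add: inv_mult_group flip: m_assoc)
      ultimately show ?thesis by (force simp: xP_def)
    qed
  qed
  \<comment> \<open>Only the cluster at \<open>x\<close> is kept. On \<open>xQ\<close> it agrees
    with \<open>green x\<close> at each point and its neighbours, and \<open>B\<close> is far away;
    off \<open>xQ\<close> the point and its neighbours carry 0.\<close>
  define \<chi> where "\<chi> = (\<lambda>z. if z \<in> xP then green x z else 0)"
  have "x \<in> xP" using x by (auto simp: xP_def P_def intro!: image_eqI[of _ _ \<one>])
  have L\<chi>: "Lap \<chi> = delta x"
  proof
    fix z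
    show "Lap \<chi> z = delta x z"
    proof (cases "z \<in> xQ")
      case True
      then have zG: "z \<in> carrier G" using x Q by (auto simp: xQ_def)
      have "z \<notin> Q" using True disj by (auto simp: xQ_def)
      have eq: "\<chi> w = green x w" if "w \<notin> P" for w using that supp[of w] by (auto simp: \<chi>_def)
      have "\<chi> (z \<otimes> s) = green x (z \<otimes> s)" if "s \<in> S" for s
        using QI[OF zG that] \<open>z \<notin> Q\<close> by (intro eq) auto
      moreover have "\<chi> z = green x z" using \<open>z \<notin> Q\<close> sub by (intro eq) auto
      ultimately have "Lap \<chi> z = Lap (green x) z" by (simp add: Lap_def)
      also have "\<dots> = delta x z" using \<open>z \<notin> Q\<close> x by (intro Lap_green) (auto simp: Q_def P_def)
      finally show ?thesis .
    next
      case False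
      have "\<chi> (z \<otimes> s) = 0" if "z \<in> carrier G" "s \<in> S" for s
        using False xQI[OF that] by (auto simp: \<chi>_def)
      moreover have "\<chi> z = 0" using False sub by (auto simp: \<chi>_def)
      ultimately have "Lap \<chi> z = 0" by (simp add: Lap_def)
      moreover have "z \<noteq> x" using False sub \<open>x \<in> xP\<close> by auto
      ultimately show ?thesis by simp
    qed
  qed
  have "\<chi> \<in> finsup" using P x by (intro finsupI[of xP]) (auto simp: xP_def \<chi>_def)
  \<comment> \<open>Pairing with the constant 1: the total mass of a Laplacian of finite support is
    0, here it would be 1.\<close>
  then have "(\<Sum>z\<in>{x}. 1 * Lap \<chi> z) = 0"
    by (intro sum_harmonic_Lap[of "\<lambda>x. 1"] constant_harmonic) (auto simp: L\<chi>)
  then show False by (simp add: L\<chi>)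
qed

text \<open>The Green function of \<open>x\<close> lives near every path from \<open>\<one>\<close> to \<open>x\<close>, so each point of its support
  yields a bounded set separating \<open>\<one>\<close> from \<open>x\<close>; translate such a cut to the identity.\<close>

lemma ex_almost_inv_infinite_coinfinite:
  "\<exists>A. almost_inv A \<and> infinite A \<and> infinite (carrier G - A)"
proof -
  \<comment> \<open>The supports met in the induction along a path: \<open>green \<one>\<close> at
    its end and the correction terms of each step by \<open>s\<close>. The point
    \<open>\<one>\<close> makes \<open>K\<close> nonempty.\<close>
  define T where "T = {\<one>} \<union> {y. green \<one> y \<noteq> 0} \<union> (\<Union>(s,b)\<in>S \<times> B. {y. green (s \<otimes> b) y \<noteq> 0})"
  have T: "finite T" "T \<subseteq> carrier G"
  proof -
    have "finite {y. green x y \<noteq> 0} \<and> {y. green x y \<noteq> 0} \<subseteq> carrier G" if "x \<in> carrier G" for x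
      using finsup_green[OF that] by (simp add: finsup_def)
    note * = this[THEN conjunct1] this[THEN conjunct2]
    have sb: "s \<otimes> b \<in> carrier G" if "s \<in> S" "b \<in> B" for s b using that S_carrier B_carrier by auto
    show "finite T" unfolding T_def using *(1) sb finite_S finite_B by (auto intro!: finite_UN_I)
    show "T \<subseteq> carrier G" unfolding T_def using *(2) sb by blast
  qed
  define K where "K = (\<lambda>y. inv y) ` T"
  have K: "finite K" "K \<subseteq> carrier G" "K \<noteq> {}"
    using T by (auto simp: K_def) (auto simp: T_def)
  have KI: "p \<in> K" if "inv p \<in> T" "p \<in> carrier G" for p
    using that by (force simp: K_def)
  \<comment> \<open>Going back from \<open>p'\<close> to \<open>p\<close> multiplies the argument on
    the left by \<open>s\<close>. New support can come only from correction terms; these live in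
    \<open>T\<close>, which \<open>inv p\<close> avoids since \<open>p\<close> is off
    \<open>K\<close>.\<close>
  have path: "green (inv p \<otimes> q) (inv p) = 0" if "(p, q) \<in> (adj K)\<^sup>*" "q \<in> carrier G - K" for p q
    using that(1)
  proof (induction rule: converse_rtrancl_induct)
    case base
    have "inv q \<notin> T" using KI[of q] that(2) by auto
    then show ?case using that(2) by (auto simp: T_def)
  next
    case (step p p')
    then obtain s where s: "p \<in> carrier G - K" "p' \<in> carrier G - K" "s \<in> S" "p' = p \<otimes> s"
      by (auto simp: adj_def)
    have mem: "p \<in> carrier G" "s \<in> carrier G" "q \<in> carrier G" using s S_carrier that(2) by auto
    show ?case
    proof (rule ccontr)
      assume "green (inv p \<otimes> q) (inv p) \<noteq> 0"
      moreover have "inv p \<otimes> q = s \<otimes> (inv p' \<otimes> q)"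
        using mem s by (simp add: inv_mult_group flip: m_assoc)
      ultimately have "green (s \<otimes> (inv p' \<otimes> q)) (inv p) \<noteq> 0" by simp
      then have "green (inv p' \<otimes> q) (inv s \<otimes> inv p) \<noteq> 0 \<or> (\<exists>b\<in>B. green (s \<otimes> b) (inv p) \<noteq> 0)"
        using mem s by (intro green_translate_support) auto
      moreover have "inv s \<otimes> inv p = inv p'" using mem s by (simp add: inv_mult_group)
      ultimately have "\<exists>b\<in>B. green (s \<otimes> b) (inv p) \<noteq> 0" using step by simp
      then have "inv p \<in> T" using s by (auto simp: T_def)
      then show False using KI[of p] s by auto
    qed
  qed
  \<comment> \<open>Adding the finite components to \<open>K\<close> ensures that group elements
    outside \<open>N\<close> have infinite components.\<close>
  define N where "N = K \<union> {p \<in> carrier G - K. finite ((adj K)\<^sup>* `` {p})}"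
  have "finite N" using K finite_union_finite_components[OF K] by (simp add: N_def)
  from green_support_meets_far[OF this]
  obtain x y where xy: "x \<in> carrier G" "y \<in> carrier G" "green x y \<noteq> 0" "inv y \<notin> N" "inv y \<otimes> x \<notin> N"
    by blast
  \<comment> \<open>Then \<open>inv p \<otimes> q\<close> is \<open>x\<close> and
    \<open>inv p\<close> is \<open>y\<close>, so a path from \<open>p\<close> to \<open>q\<close>
    would force \<open>green x y\<close> to be 0.\<close>
  define p q where "p = inv y" and "q = inv y \<otimes> x"
  have pq: "p \<in> carrier G - K" "q \<in> carrier G - K"
    "infinite ((adj K)\<^sup>* `` {p})" "infinite ((adj K)\<^sup>* `` {q})"
    using xy by (auto simp: N_def p_def q_def)
  have "green (inv p \<otimes> q) (inv p) \<noteq> 0" using xy by (simp add: p_def q_def flip: m_assoc)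
  then have sep: "(p, q) \<notin> (adj K)\<^sup>*" using path pq by blast
  have "(adj K)\<^sup>* `` {q} \<subseteq> carrier G - (adj K)\<^sup>* `` {p}"
  proof
    fix z assume z: "z \<in> (adj K)\<^sup>* `` {q}"
    then have "z \<in> carrier G" using adj_rtrancl_outside pq by blast
    moreover have "(p, z) \<notin> (adj K)\<^sup>*"
      using z sep adj_rtrancl_sym[of q z K] rtrancl_trans[of p z "adj K" q] by auto
    ultimately show "z \<in> carrier G - (adj K)\<^sup>* `` {p}" by blast
  qed
  then have "infinite (carrier G - (adj K)\<^sup>* `` {p})" using pq(4) finite_subset by blast
  then show ?thesis using pq almost_inv_component[OF K(1,2) pq(1)] by blast
qed

text \<open>Each indicator is corrected by a finitely supported function until its Laplacian lives
  on \<open>B\<close>. Among too many sets some nontrivial combination is harmonic and 0 on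
  \<open>B\<close>, hence 0; the same combination of indicators then has finite support, which
  disjoint infinite sets exclude.\<close>

lemma card_disjoint_almost_inv_le:
  assumes fin: "finite \<A>" and disj: "\<And>X Y. X \<in> \<A> \<Longrightarrow> Y \<in> \<A> \<Longrightarrow> X \<noteq> Y \<Longrightarrow> X \<inter> Y = {}"
    and ai: "\<And>X. X \<in> \<A> \<Longrightarrow> almost_inv X \<and> infinite X"
  shows "card \<A> \<le> 2 * card B"
proof (rule ccontr)
  assume large: "\<not> card \<A> \<le> 2 * card B"
  let ?i = "\<lambda>X x. of_bool (x \<in> X) :: real"
  have "\<exists>\<phi>. X \<in> \<A> \<longrightarrow> \<phi> \<in> finsup \<and> (\<forall>y. y \<notin> B \<longrightarrow> Lap \<phi> y = Lap (?i X) y)" for X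
    using finsup_eq_Lap_outside_B[OF finsup_Lap_indicator, of X] ai by blast
  then have "\<exists>\<phi>. \<forall>X. X \<in> \<A> \<longrightarrow> \<phi> X \<in> finsup \<and> (\<forall>y. y \<notin> B \<longrightarrow> Lap (\<phi> X) y = Lap (?i X) y)"
    by (intro choice allI)
  then obtain \<phi> where \<phi>: "\<And>X. X \<in> \<A> \<Longrightarrow> \<phi> X \<in> finsup"
    "\<And>X y. X \<in> \<A> \<Longrightarrow> y \<notin> B \<Longrightarrow> Lap (\<phi> X) y = Lap (?i X) y" by auto
  define d where "d X = (\<lambda>x. ?i X x - \<phi> X x)" for X
  \<comment> \<open>The left copy of \<open>B\<close> carries the conditions on the Laplacian, the
    right copy those on the values.\<close>
  define a where "a X j = (case j of Inl b \<Rightarrow> Lap (d X) b | Inr b \<Rightarrow> d X b)" for X j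
  have "card (B <+> B) < card \<A>" using large finite_B by (simp add: card_Plus)
  then obtain c where c: "\<exists>X\<in>\<A>. c X \<noteq> 0" "\<forall>j\<in>B <+> B. (\<Sum>X\<in>\<A>. c X * a X j) = 0"
    using underdetermined_system_nontrivial_solution[of "B <+> B" \<A> a] fin finite_B by auto
  define h where "h = (\<lambda>x. \<Sum>X\<in>\<A>. c X * d X x)"
  have d0: "Lap (d X) y = 0" if "X \<in> \<A>" "y \<notin> B" for X y
    using \<phi>(2)[OF that] by (simp add: d_def Lap_diff)
  have "Lap h y = 0" for y
  proof (cases "y \<in> B")
    case True
    then show ?thesis using c(2)[rule_format, of "Inl y"] by (simp add: h_def Lap_sum a_def InlI)
  next
    case False
    then show ?thesis by (simp add: h_def Lap_sum d0)
  qed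
  moreover have "h x = 0" if "x \<notin> carrier G" for x
  proof -
    have "d X x = 0" if X: "X \<in> \<A>" for X
      using \<phi>(1)[OF X] ai[OF X] \<open>x \<notin> carrier G\<close> by (auto simp: d_def finsup_def almost_inv_def)
    then show ?thesis by (simp add: h_def)
  qed
  ultimately have "h \<in> H" by (auto simp: H_iff)
  moreover have "h b = 0" if "b \<in> B" for b
    using c(2)[rule_format, of "Inr b"] that by (simp add: h_def a_def InrI)
  ultimately have h0: "h x = 0" for x using B_determines by blast
  define f where "f = (\<lambda>x. \<Sum>X\<in>\<A>. c X * \<phi> X x)"
  have f_eq: "f x = (\<Sum>X\<in>\<A>. c X * ?i X x)" for x
    using h0[of x] by (simp add: f_def h_def d_def right_diff_distrib sum_subtractf)
  obtain Y where Y: "Y \<in> \<A>" "c Y \<noteq> 0" using c(1) by blast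
  have "f x = c Y" if x: "x \<in> Y" for x
  proof -
    have "f x = c Y * ?i Y x + (\<Sum>X\<in>\<A> - {Y}. c X * ?i X x)"
      unfolding f_eq using fin Y(1) by (rule sum.remove)
    also have "(\<Sum>X\<in>\<A> - {Y}. c X * ?i X x) = 0"
      using disj[OF Y(1)] x by (intro sum.neutral) auto
    finally show ?thesis using x by simp
  qed
  then have "Y \<subseteq> {x. f x \<noteq> 0}" using Y by auto
  moreover have "f \<in> finsup" unfolding f_def using \<phi> by (intro finsup_sum)
  ultimately show False using ai[OF Y(1)] finite_subset by (auto simp: finsup_def)
qed

end

section \<open>Sets with finite boundary\<close>

definition almost_eq :: "'a set \<Rightarrow> 'a set \<Rightarrow> bool" where
  "almost_eq X Y \<longleftrightarrow> finite (X - Y) \<and> finite (Y - X)"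

lemma almost_eq_sym: "almost_eq X Y \<Longrightarrow> almost_eq Y X"
  by (simp add: almost_eq_def)

lemma almost_eq_trans:
  assumes "almost_eq X Y" "almost_eq Y Z" shows "almost_eq X Z"
proof -
  have "finite (X - Z)" by (rule finite_subset[of _ "(X - Y) \<union> (Y - Z)"]) (use assms in \<open>auto simp: almost_eq_def\<close>)
  moreover have "finite (Z - X)" by (rule finite_subset[of _ "(Z - Y) \<union> (Y - X)"]) (use assms in \<open>auto simp: almost_eq_def\<close>)
  ultimately show ?thesis by (simp add: almost_eq_def)
qed

text \<open>The substitute for a difference of cardinalities. As \<open>card\<close> of an infinite
  set is 0, it has this meaning only for \<open>almost_eq\<close> sets.\<close>

definition excess :: "'a set \<Rightarrow> 'a set \<Rightarrow> int" where
  "excess X Y = int (card (X - Y)) - int (card (Y - X))"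

text \<open>Common points in the window \<open>E\<close> cancel. A window shared by three sets makes
  \<open>excess_add\<close> a telescoping sum.\<close>

lemma excess_eq:
  assumes "finite E" "X - Y \<subseteq> E" "Y - X \<subseteq> E"
  shows "excess X Y = int (card (X \<inter> E)) - int (card (Y \<inter> E))"
proof -
  have split: "card (X \<inter> E) = card (X - Y) + card (X \<inter> Y \<inter> E)" if "X - Y \<subseteq> E" for X Y
  proof -
    have "X \<inter> E = (X - Y) \<union> (X \<inter> Y \<inter> E)" using that by auto
    moreover have "finite (X - Y)" using that assms(1) finite_subset by blast
    ultimately show ?thesis using assms(1) by (simp add: card_Un_disjoint Int_assoc disjoint_iff)
  qed
  show ?thesis
    using split[OF assms(2)] split[OF assms(3)] by (simp add: excess_def Int_commute[of X Y])
qed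

lemma excess_add:
  assumes "almost_eq X Y" "almost_eq Y Z"
  shows "excess X Z = excess X Y + excess Y Z"
proof -
  define E where "E = (X - Y) \<union> (Y - X) \<union> (Y - Z) \<union> (Z - Y)"
  have "finite E" using assms by (auto simp: E_def almost_eq_def)
  moreover have "X - Z \<subseteq> E" "Z - X \<subseteq> E" "X - Y \<subseteq> E" "Y - X \<subseteq> E" "Y - Z \<subseteq> E" "Z - Y \<subseteq> E"
    unfolding E_def by blast+
  ultimately show ?thesis by (simp add: excess_eq)
qed

section \<open>Translates and maximal disjoint families of sets with finite boundary\<close>

context symmetric_walk
begin

abbreviation tr :: "'a \<Rightarrow> 'a set \<Rightarrow> 'a set" where
  "tr g A \<equiv> (\<lambda>x. g \<otimes> x) ` A"

lemma inj_tr: "g \<in> carrier G \<Longrightarrow> inj_on (\<lambda>x. g \<otimes> x) (carrier G)"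
  by (auto intro: inj_onI)

lemma tr_carrier: "g \<in> carrier G \<Longrightarrow> A \<subseteq> carrier G \<Longrightarrow> tr g A \<subseteq> carrier G"
  by auto

lemma mem_tr_mult:
  assumes "g \<in> carrier G" "A \<subseteq> carrier G" "x \<in> carrier G"
  shows "g \<otimes> x \<in> tr g A \<longleftrightarrow> x \<in> A"
  using inj_on_image_mem_iff[OF inj_tr[OF assms(1)] assms(3,2)] .

lemma mem_tr:
  assumes "g \<in> carrier G" "A \<subseteq> carrier G" "x \<in> carrier G"
  shows "x \<in> tr g A \<longleftrightarrow> inv g \<otimes> x \<in> A"
  using mem_tr_mult[OF assms(1,2), of "inv g \<otimes> x"] assms by (simp flip: m_assoc)

lemma tr_tr: "g \<in> carrier G \<Longrightarrow> h \<in> carrier G \<Longrightarrow> A \<subseteq> carrier G \<Longrightarrow> tr g (tr h A) = tr (g \<otimes> h) A"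
  by (force simp: m_assoc image_image intro!: image_cong)

lemma tr_one: "A \<subseteq> carrier G \<Longrightarrow> tr \<one> A = A"
  by force

lemma tr_diff:
  assumes "g \<in> carrier G" "X \<subseteq> carrier G" "Y \<subseteq> carrier G"
  shows "tr g X - tr g Y = tr g (X - Y)"
  using inj_on_image_set_diff[OF inj_tr[OF assms(1)], of X Y] assms by auto

lemma card_tr: "g \<in> carrier G \<Longrightarrow> X \<subseteq> carrier G \<Longrightarrow> card (tr g X) = card X"
  by (intro card_image inj_on_subset[OF inj_tr])

lemma almost_eq_tr:
  assumes "g \<in> carrier G" "X \<subseteq> carrier G" "Y \<subseteq> carrier G" "almost_eq X Y"
  shows "almost_eq (tr g X) (tr g Y)"
  using assms by (simp add: almost_eq_def tr_diff)

lemma excess_tr: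
  assumes "g \<in> carrier G" "X \<subseteq> carrier G" "Y \<subseteq> carrier G"
  shows "excess (tr g X) (tr g Y) = excess X Y"
proof -
  have "X - Y \<subseteq> carrier G" "Y - X \<subseteq> carrier G" using assms by auto
  then show ?thesis using assms by (simp add: excess_def tr_diff card_tr)
qed

text \<open>Left translation is an automorphism of the Cayley graph.\<close>

lemma bdry_tr:
  assumes g: "g \<in> carrier G" and A: "A \<subseteq> carrier G"
  shows "bdry (tr g A) = tr g (bdry A)"
proof -
  have "x \<in> bdry (tr g A) \<longleftrightarrow> x \<in> tr g (bdry A)" if x: "x \<in> carrier G" for x
  proof -
    have "(x \<otimes> s \<in> tr g A) = (inv g \<otimes> x \<otimes> s \<in> A)" if "s \<in> S" for s
      using mem_tr[OF g A, of "x \<otimes> s"] g x S_carrier[OF that] by (simp add: m_assoc)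
    then have "x \<in> bdry (tr g A) \<longleftrightarrow> inv g \<otimes> x \<in> bdry A"
      using g x mem_tr[OF g A x] by (auto simp: bdry_def)
    also have "\<dots> \<longleftrightarrow> x \<in> tr g (bdry A)"
      using mem_tr[OF g _ x, of "bdry A"] by (auto simp: bdry_def)
    finally show ?thesis .
  qed
  moreover have "bdry (tr g A) \<subseteq> carrier G" "tr g (bdry A) \<subseteq> carrier G" using g by (auto simp: bdry_def)
  ultimately show ?thesis by blast
qed

lemma bdry_compl: "bdry (carrier G - A) = bdry A"
  using S_carrier by (auto simp: bdry_def)

lemma almost_inv_tr: "g \<in> carrier G \<Longrightarrow> almost_inv A \<Longrightarrow> almost_inv (tr g A)"
  using tr_carrier bdry_tr by (auto simp: almost_inv_def)

lemma almost_inv_Int: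
  assumes "almost_inv A" "almost_inv C" shows "almost_inv (A \<inter> C)"
proof -
  have "bdry (A \<inter> C) \<subseteq> bdry A \<union> bdry C" by (auto simp: bdry_def)
  then show ?thesis using assms finite_subset by (auto simp: almost_inv_def)
qed

lemma almost_inv_Diff:
  assumes "almost_inv A" "almost_inv C" shows "almost_inv (A - C)"
proof -
  have "bdry (A - C) \<subseteq> bdry A \<union> bdry C" by (auto simp: bdry_def)
  then show ?thesis using assms finite_subset by (auto simp: almost_inv_def)
qed

lemma almost_inv_Union:
  assumes "finite \<A>" "\<And>X. X \<in> \<A> \<Longrightarrow> almost_inv X" shows "almost_inv (\<Union>\<A>)"
proof -
  have "bdry (\<Union>\<A>) \<subseteq> (\<Union>X\<in>\<A>. bdry X)" by (auto simp: bdry_def)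
  moreover have "finite (\<Union>X\<in>\<A>. bdry X)" using assms by (auto simp: almost_inv_def)
  ultimately have "finite (bdry (\<Union>\<A>))" by (rule finite_subset)
  then show ?thesis using assms(2) by (auto simp: almost_inv_def)
qed

text \<open>The largest possible size counts the ends of the Cayley graph.\<close>

definition end_family :: "'a set set \<Rightarrow> bool" where
  "end_family \<A> \<longleftrightarrow> finite \<A> \<and> (\<forall>X\<in>\<A>. almost_inv X \<and> infinite X) \<and>
     (\<forall>X\<in>\<A>. \<forall>Y\<in>\<A>. X \<noteq> Y \<longrightarrow> X \<inter> Y = {})"

text \<open>By maximality \<open>Y\<close> cannot cut a member into two infinite halves, and no
  infinite remainder outside the members is left to be added. So up to finite sets the members met
  infinitely often determine the set.\<close>

lemma maximal_end_family_classifies: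
  assumes \<A>: "end_family \<A>" and max: "\<And>\<B>. end_family \<B> \<Longrightarrow> card \<B> \<le> card \<A>"
    and X: "almost_inv X" and Y: "almost_inv Y"
    and code: "{D \<in> \<A>. infinite (X \<inter> D)} = {D \<in> \<A>. infinite (Y \<inter> D)}"
  shows "finite (X - Y)"
proof (rule ccontr)
  assume inf: "infinite (X - Y)"
  have fin\<A>: "finite \<A>" using \<A> by (simp add: end_family_def)
  have unsplit: "finite (D \<inter> Y) \<or> finite (D - Y)" if D: "D \<in> \<A>" for D
  proof (rule ccontr)
    assume "\<not> ?thesis"
    then have i: "infinite (D \<inter> Y)" "infinite (D - Y)" by auto
    define \<B> where "\<B> = insert (D \<inter> Y) (insert (D - Y) (\<A> - {D}))"
    have aD: "almost_inv D" using \<A> D by (simp add: end_family_def)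
    have sep: "Z \<inter> D = {}" if "Z \<in> \<A> - {D}" for Z using \<A> D that by (auto simp: end_family_def)
    have "end_family \<B>"
      unfolding end_family_def
    proof (intro conjI ballI impI)
      show "finite \<B>" using fin\<A> by (simp add: \<B>_def)
      show "almost_inv Z" "infinite Z" if "Z \<in> \<B>" for Z
        using that i almost_inv_Int[OF aD Y] almost_inv_Diff[OF aD Y] \<A>
        by (auto simp: \<B>_def end_family_def)
      show "Z \<inter> Z' = {}" if "Z \<in> \<B>" "Z' \<in> \<B>" "Z \<noteq> Z'" for Z Z'
      proof (cases "Z \<in> \<A> - {D} \<and> Z' \<in> \<A> - {D}")
        case True
        then show ?thesis using \<A> that(3) unfolding end_family_def by blast
      next
        case False
        then show ?thesis using that sep[of Z] sep[of Z'] by (auto simp: \<B>_def)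
      qed
    qed
    moreover have "card \<B> = Suc (card \<A>)"
    proof -
      have "D \<inter> Y \<noteq> {}" "D - Y \<noteq> {}" using i by (metis finite.emptyI)+
      then have "D \<inter> Y \<notin> \<A> - {D}" "D - Y \<notin> \<A> - {D}" "D \<inter> Y \<noteq> D - Y"
        using sep[of "D \<inter> Y"] sep[of "D - Y"] by blast+
      then have "card \<B> = Suc (Suc (card (\<A> - {D})))" using fin\<A> by (simp add: \<B>_def)
      also have "Suc (card (\<A> - {D})) = card \<A>" using fin\<A> D by (metis card_Suc_Diff1)
      finally show ?thesis .
    qed
    ultimately show False using max[of \<B>] by simp
  qed
  have small: "finite ((X - Y) \<inter> D)" if D: "D \<in> \<A>" for D
  proof (cases "infinite (X \<inter> D)")
    case True
    then have "infinite (Y \<inter> D)" using code D by blast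
    then have "finite (D - Y)" using unsplit[OF D] by (simp add: Int_commute)
    then show ?thesis by (rule rev_finite_subset) blast
  next
    case False
    then have "finite (X \<inter> D)" by simp
    then show ?thesis by (rule rev_finite_subset) blast
  qed
  define Z where "Z = (X - Y) - \<Union>\<A>"
  have "finite (\<Union>D\<in>\<A>. (X - Y) \<inter> D)" using fin\<A> small by blast
  then have "infinite ((X - Y) - (\<Union>D\<in>\<A>. (X - Y) \<inter> D))" using inf by (rule Diff_infinite_finite)
  moreover have "(X - Y) - (\<Union>D\<in>\<A>. (X - Y) \<inter> D) = Z" by (auto simp: Z_def)
  ultimately have iZ: "infinite Z" by simp
  have "almost_inv Z"
    unfolding Z_def using \<A> X Y
    by (intro almost_inv_Diff almost_inv_Union) (auto simp: end_family_def)
  moreover have sepZ: "Z \<inter> D = {}" if "D \<in> \<A>" for D using that by (auto simp: Z_def)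
  ultimately have "end_family (insert Z \<A>)"
    using \<A> iZ unfolding end_family_def by auto
  moreover have "Z \<noteq> {}" using iZ by auto
  then have "Z \<notin> \<A>" using sepZ[of Z] by auto
  ultimately show False using max[of "insert Z \<A>"] fin\<A> by simp
qed

section \<open>Balls and nested translates\<close>

primrec ball :: "nat \<Rightarrow> 'a set" where
  "ball 0 = {\<one>}"
| "ball (Suc n) = ball n \<union> (\<lambda>(x, s). x \<otimes> s) ` (ball n \<times> S)"

lemma finite_ball: "finite (ball n)"
  by (induction n) (auto simp: finite_S)

lemma ball_carrier: "ball n \<subseteq> carrier G"
  by (induction n) (auto simp: S_carrier)

lemma one_in_ball: "\<one> \<in> ball n"
  by (induction n) auto

lemma ball_mono: "m \<le> n \<Longrightarrow> ball m \<subseteq> ball n"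
  by (induction rule: dec_induct) auto

lemma Union_ball: "(\<Union>n. ball n) = carrier G"
proof (rule step_closed_eq_carrier)
  show "(\<Union>n. ball n) \<subseteq> carrier G" using ball_carrier by blast
  show "(\<Union>n. ball n) \<noteq> {}" using one_in_ball by blast
  fix x s assume "x \<in> (\<Union>n. ball n)" "s \<in> S"
  then obtain n where "x \<in> ball n" by blast
  then have "x \<otimes> s \<in> ball (Suc n)" using \<open>s \<in> S\<close> by force
  then show "x \<otimes> s \<in> (\<Union>n. ball n)" by blast
qed

lemma finite_subset_ball:
  assumes "finite P" "P \<subseteq> carrier G" shows "\<exists>n. P \<subseteq> ball n"
  using assms
proof (induction P rule: finite_induct)
  case (insert x P)
  then obtain n where "P \<subseteq> ball n" by auto
  moreover have "x \<in> (\<Union>n. ball n)" using insert.prems by (simp add: Union_ball)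
  then obtain m where "x \<in> ball m" by blast
  ultimately have "insert x P \<subseteq> ball (max m n)"
    using ball_mono[of m "max m n"] ball_mono[of n "max m n"] by auto
  then show ?case by blast
qed simp

text \<open>Each point of the translated ball is joined to its centre \<open>g\<close> by a path
  inside it, and changing sides along an edge requires a boundary point.\<close>

lemma ball_on_one_side:
  assumes g: "g \<in> carrier G" and off: "\<And>z. z \<in> ball n \<Longrightarrow> g \<otimes> z \<notin> bdry X" and z: "z \<in> ball n"
  shows "g \<otimes> z \<in> X \<longleftrightarrow> g \<in> X"
proof -
  have "m \<le> n \<Longrightarrow> z \<in> ball m \<Longrightarrow> g \<otimes> z \<in> X \<longleftrightarrow> g \<in> X" for m z
  proof (induction m arbitrary: z)
    case 0 then show ?case using g by simp
  next
    case (Suc m)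
    show ?case
    proof (cases "z \<in> ball m")
      case True then show ?thesis using Suc by simp
    next
      case False
      then obtain w s where w: "w \<in> ball m" "s \<in> S" "z = w \<otimes> s" using Suc.prems by auto
      have wG: "w \<in> carrier G" using w ball_carrier by blast
      have "w \<in> ball n" using w ball_mono[of m n] Suc.prems by auto
      then have "g \<otimes> w \<in> X \<longleftrightarrow> g \<otimes> w \<otimes> s \<in> X"
        using off[of w] w g wG by (auto simp: bdry_def)
      then show ?thesis using Suc w g wG S_carrier by (simp add: m_assoc)
    qed
  qed
  then show ?thesis using z by blast
qed

text \<open>The intersection avoids both boundaries, so no step leaves it: it is empty or
  everything.\<close>

lemma disjoint_if_boundaries_disjoint:
  assumes "A \<subseteq> carrier G" "C \<subseteq> carrier G" "bdry A \<inter> C = {}" "bdry C \<inter> A = {}" "A \<noteq> carrier G"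
  shows "A \<inter> C = {}"
proof (rule ccontr)
  assume "A \<inter> C \<noteq> {}"
  moreover have "x \<otimes> s \<in> A \<inter> C" if "x \<in> A \<inter> C" "s \<in> S" for x s
    using assms that by (auto simp: bdry_def)
  ultimately have "A \<inter> C = carrier G" using assms by (intro step_closed_eq_carrier) auto
  then show False using assms by auto
qed

section \<open>The stabiliser of a cut and its shift homomorphism\<close>

definition stab :: "'a set \<Rightarrow> 'a set" where
  "stab A = {g \<in> carrier G. almost_eq (tr g A) A}"

text \<open>For the integers, with \<open>A\<close> the natural numbers, the shift of
  \<open>g\<close> is \<open>g\<close> itself.\<close>

definition shift :: "'a set \<Rightarrow> 'a \<Rightarrow> int" where
  "shift A g = excess A (tr g A)"

text \<open>If \<open>g\<close> moves a ball around the boundary of \<open>A\<close> off itself, then \<open>A\<close> and its translate are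
  nested, so the shift of \<open>g\<close> is nonzero.\<close>

lemma finite_shift_zero:
  assumes A: "almost_inv A" "infinite A" "infinite (carrier G - A)"
  shows "finite {g \<in> stab A. shift A g = 0}"
proof -
  have sub: "A \<subseteq> carrier G" using A by (simp add: almost_inv_def)
  have ne: "A \<noteq> {}" "carrier G - A \<noteq> {}" using A by (auto dest: infinite_imp_nonempty)
  then obtain a where a: "a \<in> A" by blast
  obtain a' where a': "a' \<in> carrier G" "a' \<notin> A" using ne by blast
  \<comment> \<open>The points \<open>a\<close> and \<open>a'\<close> are put into the ball so that
    their translates by \<open>g\<close> lie in \<open>D'\<close> and witness that the nesting is
    strict.\<close>
  have fin: "finite (bdry A \<union> {a, a'})" using A by (simp add: almost_inv_def)
  have "bdry A \<subseteq> carrier G" by (auto simp: bdry_def)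
  then have "bdry A \<union> {a, a'} \<subseteq> carrier G" using a a' sub by blast
  from finite_subset_ball[OF fin this] obtain n where n: "bdry A \<union> {a, a'} \<subseteq> ball n" by blast
  let ?D = "ball n"
  have "g \<in> (\<lambda>(x, y). x \<otimes> inv y) ` (?D \<times> ?D)" if g: "g \<in> stab A" and zero: "shift A g = 0" for g
  proof (rule ccontr)
    assume far: "\<not> ?thesis"
    have gG: "g \<in> carrier G" and eq: "almost_eq (tr g A) A" using g by (auto simp: stab_def)
    define A' D' where "A' = tr g A" and "D' = tr g ?D"
    have disj: "g \<otimes> z \<notin> ?D" if z: "z \<in> ?D" for z
    proof
      assume "g \<otimes> z \<in> ?D"
      moreover have "z \<in> carrier G" using z ball_carrier by blast
      then have "g = g \<otimes> z \<otimes> inv z" using gG by (simp add: m_assoc)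
      ultimately show False using far z by (auto intro: image_eqI[of _ _ "(g \<otimes> z, z)"])
    qed
    have A'c: "A' \<subseteq> carrier G" using gG sub by (auto simp: A'_def)
    have bA: "bdry A \<subseteq> ?D" using n by simp
    have "bdry A' = tr g (bdry A)" unfolding A'_def by (rule bdry_tr[OF gG sub])
    then have bA': "bdry A' \<subseteq> D'" unfolding D'_def using bA by (simp add: image_mono)
    have off: "g \<otimes> z \<notin> bdry A" if "z \<in> ?D" for z using disj[OF that] bA by auto
    have D': "D' \<subseteq> A \<or> D' \<inter> A = {}"
      using ball_on_one_side[OF gG off] by (cases "g \<in> A") (auto simp: D'_def)
    have off': "\<one> \<otimes> z \<notin> bdry A'" if "z \<in> ?D" for z
    proof -
      have "\<one> \<otimes> z = z" using subsetD[OF ball_carrier that] by simp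
      moreover have "z \<notin> D'" using disj that by (auto simp: D'_def)
      ultimately show ?thesis using bA' by auto
    qed
    have "z \<in> A' \<longleftrightarrow> \<one> \<in> A'" if z: "z \<in> ?D" for z
      using ball_on_one_side[OF one_closed off' z] subsetD[OF ball_carrier z] by simp
    then have D: "?D \<subseteq> A' \<or> ?D \<inter> A' = {}" by (cases "\<one> \<in> A'") auto
    have ga: "g \<otimes> a \<in> D'" "g \<otimes> a \<in> A'" using a n by (auto simp: D'_def A'_def)
    have ga': "g \<otimes> a' \<in> D'" "g \<otimes> a' \<notin> A'"
      using mem_tr_mult[OF gG sub a'(1)] a' n by (auto simp: D'_def A'_def)
    have neq: "A \<noteq> carrier G" "carrier G - A \<noteq> carrier G" using a a' sub by auto
    have fin: "finite (A - A')" "finite (A' - A)" using eq by (auto simp: almost_eq_def A'_def)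
    have zero': "card (A - A') = card (A' - A)"
      using zero by (simp add: shift_def excess_def A'_def)
    \<comment> \<open>Cases 2 and 3 nest \<open>A\<close> and \<open>A'\<close> strictly, so the
      shift is nonzero. In cases 1 and 4 they cover the group or are disjoint, impossible for sets
      that differ finitely.\<close>
    consider "D' \<subseteq> A" "?D \<subseteq> A'" | "D' \<subseteq> A" "?D \<inter> A' = {}"
      | "D' \<inter> A = {}" "?D \<subseteq> A'" | "D' \<inter> A = {}" "?D \<inter> A' = {}"
      using D D' by blast
    then show False
    proof cases
      case 1
      have "(carrier G - A) \<inter> (carrier G - A') = {}"
        by (rule disjoint_if_boundaries_disjoint) (use neq bA bA' 1 in \<open>auto simp: bdry_compl\<close>)
      then have "carrier G - A \<subseteq> A' - A" by blast
      then show False using fin(2) A(3) finite_subset by blast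
    next
      case 2
      have "(carrier G - A) \<inter> A' = {}"
        by (rule disjoint_if_boundaries_disjoint) (use neq A'c bA bA' 2 in \<open>auto simp: bdry_compl\<close>)
      then have "A' - A = {}" using A'c by blast
      moreover have "g \<otimes> a' \<in> A - A'" using ga' 2 by blast
      ultimately show False using fin zero' by (metis card_0_eq card.empty empty_iff)
    next
      case 3
      have "A \<inter> (carrier G - A') = {}"
        by (rule disjoint_if_boundaries_disjoint) (use neq sub bA bA' 3 in \<open>auto simp: bdry_compl\<close>)
      then have "A - A' = {}" using sub by blast
      moreover have "g \<otimes> a \<in> A' - A" using ga 3 by blast
      ultimately show False using fin zero' by (metis card_0_eq card.empty empty_iff)
    next
      case 4
      have "A \<inter> A' = {}"
        by (rule disjoint_if_boundaries_disjoint) (use neq sub A'c bA bA' 4 in auto)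
      then have "A \<subseteq> A - A'" by blast
      then show False using fin(1) A(2) finite_subset by blast
    qed
  qed
  then have "{g \<in> stab A. shift A g = 0} \<subseteq> (\<lambda>(x, y). x \<otimes> inv y) ` (?D \<times> ?D)" by blast
  then show ?thesis by (rule finite_subset) (use finite_ball in auto)
qed

lemma stab_subgroup:
  assumes A: "A \<subseteq> carrier G" shows "subgroup (stab A) G"
proof (rule subgroupI)
  show "stab A \<subseteq> carrier G" by (auto simp: stab_def)
  show "stab A \<noteq> {}" using tr_one[OF A] by (auto simp: stab_def almost_eq_def intro!: exI[of _ \<one>])
  fix g assume "g \<in> stab A"
  then have g: "g \<in> carrier G" "almost_eq (tr g A) A" by (auto simp: stab_def)
  have "almost_eq (tr (inv g) (tr g A)) (tr (inv g) A)"
    using g A tr_carrier by (intro almost_eq_tr) auto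
  then have "almost_eq A (tr (inv g) A)" using g A by (simp add: tr_tr tr_one)
  then show "inv g \<in> stab A" using g almost_eq_sym by (auto simp: stab_def)
  fix h assume "h \<in> stab A"
  then have h: "h \<in> carrier G" "almost_eq (tr h A) A" by (auto simp: stab_def)
  have "almost_eq (tr g (tr h A)) (tr g A)"
    using g h A tr_carrier by (intro almost_eq_tr) auto
  then have "almost_eq (tr (g \<otimes> h) A) A" using g h A almost_eq_trans by (simp add: tr_tr) blast
  then show "g \<otimes> h \<in> stab A" using g h by (auto simp: stab_def)
qed

text \<open>Additivity of the excess along \<open>A\<close>, \<open>g A\<close>,
  \<open>g h A\<close>, where the second part is a translate by \<open>g\<close> of the excess for
  \<open>h\<close>.\<close>

lemma shift_mult:
  assumes A: "A \<subseteq> carrier G" and g: "g \<in> stab A" and h: "h \<in> stab A"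
  shows "shift A (g \<otimes> h) = shift A g + shift A h"
proof -
  have gh: "g \<in> carrier G" "h \<in> carrier G" "almost_eq A (tr g A)" "almost_eq A (tr h A)"
    using g h almost_eq_sym by (auto simp: stab_def)
  have "almost_eq (tr g A) (tr g (tr h A))" using gh A tr_carrier by (intro almost_eq_tr) auto
  then have "excess A (tr g (tr h A)) = excess A (tr g A) + excess (tr g A) (tr g (tr h A))"
    using gh by (intro excess_add) auto
  then show ?thesis using gh A tr_carrier by (simp add: shift_def tr_tr[symmetric] excess_tr)
qed

lemma shift_int_pow:
  assumes A: "A \<subseteq> carrier G" and t: "t \<in> stab A"
  shows "t [^] (i::int) \<in> stab A" and "shift A (t [^] i) = i * shift A t"
proof -
  interpret st: subgroup "stab A" G by (rule stab_subgroup[OF A])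
  have tG: "t \<in> carrier G" by (rule st.mem_carrier[OF t])
  have one: "shift A \<one> = 0" using tr_one[OF A] by (simp add: shift_def excess_def)
  have nat: "t [^] n \<in> stab A \<and> shift A (t [^] n) = int n * shift A t" for n :: nat
  proof (induction n)
    case 0 then show ?case using one by simp
  next
    case (Suc n)
    then show ?case using t shift_mult[OF A, of "t [^] n" t] by (simp add: distrib_right)
  qed
  have inv: "shift A (inv g) = - shift A g" if "g \<in> stab A" for g
    using shift_mult[OF A st.m_inv_closed[OF that] that] one st.mem_carrier[OF that] by simp
  have "t [^] i \<in> stab A \<and> shift A (t [^] i) = i * shift A t"
  proof (cases i rule: int_cases2)
    case (nonneg n) then show ?thesis using nat[of n] by (simp add: int_pow_int)
  next
    case (nonpos n)
    then have "t [^] i = inv (t [^] n)" using int_pow_neg_int[OF tG] by simp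
    then show ?thesis using nat[of n] inv[of "t [^] n"] nonpos by simp
  qed
  then show "t [^] i \<in> stab A" "shift A (t [^] i) = i * shift A t" by auto
qed

text \<open>Two finite indices are combined: that of \<open>stab A\<close> in \<open>G\<close>, as
  only finitely many codes exist, and that of the powers of \<open>t\<close> in
  \<open>stab A\<close>, as the shift has finite kernel.\<close>

lemma virtually_Z_if_boundedly_many_ends:
  assumes A: "almost_inv A" "infinite A" "infinite (carrier G - A)"
    and bound: "\<And>\<A>. end_family \<A> \<Longrightarrow> card \<A> \<le> k"
  shows "\<exists>K. subgroup K G \<and> finite (rcosets K) \<and> G\<lparr>carrier := K\<rparr> \<cong> integer_group"
proof -
  have sub: "A \<subseteq> carrier G" using A by (simp add: almost_inv_def)
  interpret st: subgroup "stab A" G by (rule stab_subgroup[OF sub])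
  have "end_family {}" by (simp add: end_family_def)
  then have "\<exists>\<A>. end_family \<A> \<and> (\<forall>\<B>. end_family \<B> \<longrightarrow> card \<B> \<le> card \<A>)"
    using bound by (intro ex_has_greatest_nat[of _ _ _ "Suc k"]) (auto simp: less_Suc_eq_le)
  then obtain \<A> where \<A>: "end_family \<A>" "\<And>\<B>. end_family \<B> \<Longrightarrow> card \<B> \<le> card \<A>" by blast
  \<comment> \<open>Equal codes of \<open>x\<close> and \<open>r\<close> mean that
    \<open>inv x\<close> and \<open>inv r\<close> move \<open>A\<close> to almost equal sets, so
    that \<open>x \<otimes> inv r\<close> lies in \<open>stab A\<close>.\<close>
  define code where "code x = {D \<in> \<A>. infinite (tr (inv x) A \<inter> D)}" for x
  define rep where "rep v = (SOME r. r \<in> carrier G \<and> code r = v)" for v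
  define R where "R = (\<lambda>x. rep (code x)) ` carrier G"
  have rep: "rep (code x) \<in> carrier G \<and> code (rep (code x)) = code x" if "x \<in> carrier G" for x
    unfolding rep_def by (rule someI_ex) (use that in blast)
  have "code ` carrier G \<subseteq> Pow \<A>" by (auto simp: code_def)
  then have "finite (code ` carrier G)"
    by (rule finite_subset) (use \<A> in \<open>auto simp: end_family_def\<close>)
  then have "finite (rep ` code ` carrier G)" by simp
  then have finR: "finite R" by (simp add: R_def image_image)
  have RG: "R \<subseteq> carrier G" using rep by (auto simp: R_def)
  have coset: "\<exists>g\<in>stab A. \<exists>r\<in>R. x = g \<otimes> r" if x: "x \<in> carrier G" for x
  proof -
    define r where "r = rep (code x)"
    have r: "r \<in> carrier G" "code r = code x" "r \<in> R" using rep[OF x] x by (auto simp: r_def R_def)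
    have ai: "almost_inv (tr (inv x) A)" "almost_inv (tr (inv r) A)"
      by (intro almost_inv_tr inv_closed x r A)+
    have "finite (tr (inv x) A - tr (inv r) A)"
      using maximal_end_family_classifies[OF \<A> ai] r(2) unfolding code_def by blast
    moreover have "finite (tr (inv r) A - tr (inv x) A)"
      using maximal_end_family_classifies[OF \<A> ai(2,1)] r(2) unfolding code_def by blast
    ultimately have "almost_eq (tr (inv r) A) (tr (inv x) A)" by (simp only: almost_eq_def)
    then have "almost_eq (tr x (tr (inv r) A)) (tr x (tr (inv x) A))"
      by (intro almost_eq_tr tr_carrier inv_closed x r sub)
    then have "almost_eq (tr (x \<otimes> inv r) A) A"
      using x r(1) sub by (simp only: tr_tr tr_one inv_closed r_inv)
    then have "x \<otimes> inv r \<in> stab A" using x r(1) unfolding stab_def by simp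
    moreover have "x = x \<otimes> inv r \<otimes> r" using x r by (simp add: m_assoc)
    ultimately show ?thesis using r by blast
  qed
  have "infinite (stab A)"
  proof
    assume "finite (stab A)"
    then have "finite ((\<lambda>(g, r). g \<otimes> r) ` (stab A \<times> R))" using finR by auto
    moreover have "carrier G \<subseteq> (\<lambda>(g, r). g \<otimes> r) ` (stab A \<times> R)" using coset by force
    ultimately show False using infinite_carrier finite_subset by blast
  qed
  moreover have ker: "finite {g \<in> stab A. shift A g = 0}" by (rule finite_shift_zero[OF A])
  ultimately have "\<not> stab A \<subseteq> {g \<in> stab A. shift A g = 0}" using finite_subset by blast
  then obtain t0 where t0: "t0 \<in> stab A" "shift A t0 \<noteq> 0" by blast
  \<comment> \<open>The exponent, 1 or -1, makes the shift positive, so that division with remainder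
    by it applies.\<close>
  define t where "t = t0 [^] sgn (shift A t0)"
  have t: "t \<in> stab A" "shift A t > 0"
    using shift_int_pow[OF sub t0(1)] t0(2) by (auto simp: t_def sgn_if)
  have tG: "t \<in> carrier G" by (rule st.mem_carrier[OF t(1)])
  define m where "m = shift A t"
  \<comment> \<open>Remainders of the shift modulo \<open>m\<close>: a power of \<open>t\<close>
    brings every element of \<open>stab A\<close> into this set, which is finite because each fibre
    of the shift lies in a translate of the kernel.\<close>
  define \<Phi> where "\<Phi> = {g \<in> stab A. shift A g \<in> {0..<m}}"
  have fibre: "finite {g \<in> stab A. shift A g = j}" for j
  proof (cases "\<exists>g. g \<in> stab A \<and> shift A g = j")
    case True
    then obtain g where g: "g \<in> stab A" "shift A g = j" by blast
    have gG: "g \<in> carrier G" by (rule st.mem_carrier[OF g(1)])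
    have "{h \<in> stab A. shift A h = j} \<subseteq> tr g {h \<in> stab A. shift A h = 0}"
    proof
      fix h assume "h \<in> {h \<in> stab A. shift A h = j}"
      then have h: "h \<in> stab A" "shift A h = j" "h \<in> carrier G" by auto
      have "inv g \<otimes> h \<in> stab A" using g h by auto
      moreover have h_eq: "h = g \<otimes> (inv g \<otimes> h)" using gG h by (simp flip: m_assoc)
      then have "shift A h = shift A g + shift A (inv g \<otimes> h)"
        using shift_mult[OF sub g(1) \<open>inv g \<otimes> h \<in> stab A\<close>] by simp
      ultimately show "h \<in> tr g {h \<in> stab A. shift A h = 0}" 
        using h_eq g(2) h(2) by (intro image_eqI[of _ _ "inv g \<otimes> h"]) auto
    qed
    then show ?thesis by (rule finite_subset) (use ker in auto)
  next
    case False
    then have "{g \<in> stab A. shift A g = j} = {}" by blast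
    then show ?thesis by (simp only: finite.emptyI)
  qed
  have "\<Phi> = (\<Union>j\<in>{0..<m}. {g \<in> stab A. shift A g = j})" by (auto simp: \<Phi>_def)
  then have fin\<Phi>: "finite \<Phi>" using fibre by simp
  define K where "K = range (\<lambda>i::int. t [^] i)"
  have K: "subgroup K G"
  proof (rule subgroupI)
    show "K \<subseteq> carrier G" "K \<noteq> {}" using tG by (auto simp: K_def)
    show "inv a \<in> K" if "a \<in> K" for a
      using that tG by (auto simp: K_def int_pow_neg[symmetric])
    show "a \<otimes> b \<in> K" if "a \<in> K" "b \<in> K" for a b
      using that tG by (auto simp: K_def int_pow_mult[symmetric])
  qed
  have "rcosets K \<subseteq> (\<lambda>(p, r). K #> (p \<otimes> r)) ` (\<Phi> \<times> R)"
  proof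
    fix C assume "C \<in> rcosets K"
    then obtain x where x: "x \<in> carrier G" "C = K #> x" by (auto simp: RCOSETS_def)
    obtain g r where gr: "g \<in> stab A" "r \<in> R" "x = g \<otimes> r" using coset[OF x(1)] by blast
    have mem: "g \<in> carrier G" "r \<in> carrier G" using gr RG by auto
    define q where "q = shift A g div m"
    define p where "p = t [^] (- q) \<otimes> g"
    have "shift A p = - q * m + shift A g"
      using shift_mult[OF sub shift_int_pow(1)[OF sub t(1)] gr(1), of "- q"]
        shift_int_pow(2)[OF sub t(1), of "- q"] by (simp add: p_def m_def)
    also have "\<dots> = shift A g mod m" by (simp add: q_def minus_div_mult_eq_mod[symmetric])
    finally have "p \<in> \<Phi>"
      using t shift_int_pow(1)[OF sub t(1)] gr by (auto simp: \<Phi>_def m_def p_def)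
    have pG: "p \<in> carrier G" using tG mem by (simp add: p_def)
    have "g = t [^] q \<otimes> p" using tG mem by (simp add: p_def int_pow_neg flip: m_assoc)
    then have "x = t [^] q \<otimes> (p \<otimes> r)" using gr mem tG pG by (simp add: m_assoc)
    then have "x \<in> K #> (p \<otimes> r)" by (auto simp: r_coset_def K_def)
    then have "C = K #> (p \<otimes> r)" using repr_independence[OF _ _ K] pG mem x by simp
    then show "C \<in> (\<lambda>(p, r). K #> (p \<otimes> r)) ` (\<Phi> \<times> R)" using \<open>p \<in> \<Phi>\<close> gr by force
  qed
  then have finK: "finite (rcosets K)" by (rule finite_subset) (use fin\<Phi> finR in auto)
  have "inj (\<lambda>i::int. t [^] i)"
  proof (rule injI)
    fix i j :: int assume "t [^] i = t [^] j"
    then have "i * shift A t = j * shift A t" using shift_int_pow(2)[OF sub t(1)] by metis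
    then show "i = j" using t by simp
  qed
  then have "(\<lambda>i::int. t [^] i) \<in> iso integer_group (G\<lparr>carrier := K\<rparr>)"
    using tG by (auto simp: iso_def hom_def bij_betw_def K_def int_pow_mult)
  then have "integer_group \<cong> G\<lparr>carrier := K\<rparr>" by (auto simp: is_iso_def)
  then have "G\<lparr>carrier := K\<rparr> \<cong> integer_group" by (rule group.iso_sym[OF group_integer_group])
  then show ?thesis using K finK by blast
qed

end

lemma (in finite_dim_walk) virtually_Z:
  "\<exists>K. subgroup K G \<and> finite (rcosets K) \<and> G\<lparr>carrier := K\<rparr> \<cong> integer_group"
proof -
  obtain A where "almost_inv A" "infinite A" "infinite (carrier G - A)"
    using ex_almost_inv_infinite_coinfinite by blast
  moreover have "card \<A> \<le> 2 * card B" if "end_family \<A>" for \<A>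
    using that by (intro card_disjoint_almost_inv_le) (auto simp: end_family_def)
  ultimately show ?thesis by (rule virtually_Z_if_boundedly_many_ends)
qed

theorem theorem1p1:
  fixes G :: "('a, 'b) monoid_scheme" and \<mu> :: "'a \<Rightarrow> real"
  assumes "group G"
    and "infinite (carrier G)"
    and "fin_prob_measure G \<mu>"
    and "symmetric_measure G \<mu>"
    and "generating_measure G \<mu>"
  shows "fin_dim_fun_space (harmonic_functions G \<mu>) \<longleftrightarrow>
    (\<exists>K. subgroup K G \<and> finite (rcosets\<^bsub>G\<^esub> K) \<and> G\<lparr>carrier := K\<rparr> \<cong> integer_group)"
proof -
  interpret symmetric_walk G \<mu>
    using assms by (intro symmetric_walk.intro symmetric_walk_axioms.intro)
  show ?thesis
  proof
    assume "fin_dim_fun_space H"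
    then obtain D where "\<And>B. interpolates H B \<Longrightarrow> card B \<le> D"
      using fin_dim_bounds_interpolates by blast
    from maximal_interpolates_determines[OF subspace_H this]
    obtain B where B: "interpolates H B" "\<forall>h\<in>H. (\<forall>b\<in>B. h b = 0) \<longrightarrow> (\<forall>x. h x = 0)" by blast
    interpret finite_dim_walk G \<mu> B
      using B by unfold_locales
    show "\<exists>K. subgroup K G \<and> finite (rcosets\<^bsub>G\<^esub> K) \<and> G\<lparr>carrier := K\<rparr> \<cong> integer_group"
      by (rule virtually_Z)
  qed (use fin_dim_if_virtually_Z in blast)
qed

end
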